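(* Let $\mathfrak g$ be a Lie algebra over a field $k$ of characteristic other than $2$, and let $N=k\oplus\mathfrak g$ be the cocommutative coalgebra with comultiplication and counit given by $\Delta(1)=1\otimes 1$, $\Delta(x)=x\otimes 1+1\otimes x$, $\epsilon(1)=1$, $\epsilon(x)=0$ for $x\in\mathfrak g$. Let $q:N\otimes N\to N$ be the linear map $$q\big((a+x)\otimes(b+y)\big)=ab+bx+[x,y],\qquad a,b\in k,\ x,y\in\mathfrak g .$$ Then $(N,q)$ is a shelf in the category of cocommutative coalgebras with counit; that is, $q$ is self-distributive and is a coalgebra morphism.
   Context: For a coalgebra $(C,\Delta,\epsilon)$ with counit and flip $\tau(u\otimes v)=v\otimes u$, a linear map $q:C\otimes C\to C$ is self-distributive if $q(q\otimes 1)=q(q\otimes q)(1\otimes\tau\otimes 1)(1\otimes 1\otimes\Delta)$ on $C^{\otimes 3}$. It is a coalgebra morphism if it preserves comultiplication, $\Delta q=(q\otimes q)(1\otimes\tau\otimes 1)(\Delta\otimes\Delta)$, and counit, $\epsilon q=\epsilon\otimes\epsilon$ (identifying $k\otimes k\cong k$). A shelf in the category of (cocommutative) coalgebras with counit is a pair $(C,q)$ with $C$ an object of the category and $q:C\otimes C\to C$ a morphism of that category that is self-distributive. Inside composites, $1$ denotes the identity map. *)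

theory Defs
  imports "HOL-Algebra.Free_Abelian_Groups" "HOL-Algebra.Module" "HOL-Algebra.Multiplicative_Group"
begin

section \<open>Linear maps and tensor products of modules\<close>

text \<open>Only the additive group and the scalar multiplication of a record of type
  \<^typ>\<open>('a, 'b) module\<close> matter for the locale \<^locale>\<open>module\<close>; the multiplicative fields of
  the modules constructed below are irrelevant.\<close>

definition linear_maps ::
  "('k, 'r) ring_scheme \<Rightarrow> ('k, 'a, 'm) module_scheme \<Rightarrow> ('k, 'b, 'n) module_scheme \<Rightarrow> ('a \<Rightarrow> 'b) set"
  where "linear_maps R M N =
    {f \<in> hom (add_monoid M) (add_monoid N).
       \<forall>r\<in>carrier R. \<forall>x\<in>carrier M. f (r \<odot>\<^bsub>M\<^esub> x) = r \<odot>\<^bsub>N\<^esub> f x}"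

definition bilinear_map ::
  "('k, 'r) ring_scheme \<Rightarrow> ('k, 'a, 'm) module_scheme \<Rightarrow> ('k, 'b, 'n) module_scheme
    \<Rightarrow> ('k, 'c, 'p) module_scheme \<Rightarrow> ('a \<Rightarrow> 'b \<Rightarrow> 'c) \<Rightarrow> bool"
  where "bilinear_map R M N P f \<longleftrightarrow>
    (\<forall>x\<in>carrier M. f x \<in> linear_maps R N P) \<and>
    (\<forall>y\<in>carrier N. (\<lambda>x. f x y) \<in> linear_maps R M P)"

definition base_module :: "('k, 'r) ring_scheme \<Rightarrow> ('k, 'k) module"
  where "base_module R =
    \<lparr>carrier = carrier R, monoid.mult = monoid.mult R, monoid.one = \<one>\<^bsub>R\<^esub>, ring.zero = \<zero>\<^bsub>R\<^esub>,
     ring.add = ring.add R, smult = monoid.mult R\<rparr>"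

definition direct_sum ::
  "('k, 'a, 'm) module_scheme \<Rightarrow> ('k, 'b, 'n) module_scheme \<Rightarrow> ('k, 'a \<times> 'b) module"
  where "direct_sum M N =
    \<lparr>carrier = carrier M \<times> carrier N, monoid.mult = undefined, monoid.one = undefined,
     ring.zero = (\<zero>\<^bsub>M\<^esub>, \<zero>\<^bsub>N\<^esub>),
     ring.add = (\<lambda>(x, y) (x', y'). (x \<oplus>\<^bsub>M\<^esub> x', y \<oplus>\<^bsub>N\<^esub> y')),
     smult = (\<lambda>r (x, y). (r \<odot>\<^bsub>M\<^esub> x, r \<odot>\<^bsub>N\<^esub> y))\<rparr>"

text \<open>The tensor product of two modules over a commutative ring is the quotient of the free
  abelian group on pairs by the subgroup of bilinearity relations; elements are cosets, and a
  scalar acts on a coset by scaling the first component of every pair.\<close>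

type_synonym ('a, 'b) tensor = "(('a \<times> 'b) \<Rightarrow>\<^sub>0 int) set"

definition tensor_free ::
  "('k, 'a, 'm) module_scheme \<Rightarrow> ('k, 'b, 'n) module_scheme \<Rightarrow> (('a \<times> 'b) \<Rightarrow>\<^sub>0 int) monoid"
  where "tensor_free M N = free_Abelian_group (carrier M \<times> carrier N)"

definition tensor_rels ::
  "('k, 'r) ring_scheme \<Rightarrow> ('k, 'a, 'm) module_scheme \<Rightarrow> ('k, 'b, 'n) module_scheme
    \<Rightarrow> (('a \<times> 'b) \<Rightarrow>\<^sub>0 int) set"
  where "tensor_rels R M N =
    {frag_of (x \<oplus>\<^bsub>M\<^esub> x', y) - frag_of (x, y) - frag_of (x', y) | x x' y.
       x \<in> carrier M \<and> x' \<in> carrier M \<and> y \<in> carrier N} \<union>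
    {frag_of (x, y \<oplus>\<^bsub>N\<^esub> y') - frag_of (x, y) - frag_of (x, y') | x y y'.
       x \<in> carrier M \<and> y \<in> carrier N \<and> y' \<in> carrier N} \<union>
    {frag_of (r \<odot>\<^bsub>M\<^esub> x, y) - frag_of (x, r \<odot>\<^bsub>N\<^esub> y) | r x y.
       r \<in> carrier R \<and> x \<in> carrier M \<and> y \<in> carrier N}"

definition tensor_null ::
  "('k, 'r) ring_scheme \<Rightarrow> ('k, 'a, 'm) module_scheme \<Rightarrow> ('k, 'b, 'n) module_scheme
    \<Rightarrow> (('a \<times> 'b) \<Rightarrow>\<^sub>0 int) set"
  where "tensor_null R M N = generate (tensor_free M N) (tensor_rels R M N)"

definition tensor_class ::
  "('k, 'r) ring_scheme \<Rightarrow> ('k, 'a, 'm) module_scheme \<Rightarrow> ('k, 'b, 'n) module_scheme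
    \<Rightarrow> (('a \<times> 'b) \<Rightarrow>\<^sub>0 int) \<Rightarrow> ('a, 'b) tensor"
  where "tensor_class R M N c = tensor_null R M N #>\<^bsub>tensor_free M N\<^esub> c"

definition tensor_scale ::
  "('k, 'a, 'm) module_scheme \<Rightarrow> 'k \<Rightarrow> (('a \<times> 'b) \<Rightarrow>\<^sub>0 int) \<Rightarrow> (('a \<times> 'b) \<Rightarrow>\<^sub>0 int)"
  where "tensor_scale M r = frag_extend (\<lambda>(x, y). frag_of (r \<odot>\<^bsub>M\<^esub> x, y))"

definition tensor_product ::
  "('k, 'r) ring_scheme \<Rightarrow> ('k, 'a, 'm) module_scheme \<Rightarrow> ('k, 'b, 'n) module_scheme
    \<Rightarrow> ('k, ('a, 'b) tensor) module"
  where "tensor_product R M N =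
    (let Q = tensor_free M N Mod tensor_null R M N in
     \<lparr>carrier = carrier Q, monoid.mult = undefined, monoid.one = undefined, ring.zero = \<one>\<^bsub>Q\<^esub>,
      ring.add = monoid.mult Q,
      smult = (\<lambda>r X. \<Union>c\<in>X. tensor_class R M N (tensor_scale M r c))\<rparr>)"

definition pure_tensor ::
  "('k, 'r) ring_scheme \<Rightarrow> ('k, 'a, 'm) module_scheme \<Rightarrow> ('k, 'b, 'n) module_scheme
    \<Rightarrow> 'a \<Rightarrow> 'b \<Rightarrow> ('a, 'b) tensor"
  where "pure_tensor R M N x y = tensor_class R M N (frag_of (x, y))"

text \<open>The linear map out of a tensor product induced by a bilinear map. Existence and
  uniqueness are shown in \<open>tensor_lift\<close> and \<open>linear_maps_tensor_eqI\<close> below; to make it unique as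
  a HOL function it is taken to be undefined outside the carrier.\<close>

definition tensor_lift ::
  "('k, 'r) ring_scheme \<Rightarrow> ('k, 'a, 'm) module_scheme \<Rightarrow> ('k, 'b, 'n) module_scheme
    \<Rightarrow> ('k, 'c, 'p) module_scheme \<Rightarrow> ('a \<Rightarrow> 'b \<Rightarrow> 'c) \<Rightarrow> ('a, 'b) tensor \<Rightarrow> 'c"
  where "tensor_lift R M N P f =
    (THE h. h \<in> extensional (carrier (tensor_product R M N)) \<and>
       h \<in> linear_maps R (tensor_product R M N) P \<and>
       (\<forall>x\<in>carrier M. \<forall>y\<in>carrier N. h (pure_tensor R M N x y) = f x y))"


lemma linear_mapsI:
  assumes "\<And>x. x \<in> carrier M \<Longrightarrow> f x \<in> carrier N"
    and "\<And>x y. x \<in> carrier M \<Longrightarrow> y \<in> carrier M \<Longrightarrow> f (x \<oplus>\<^bsub>M\<^esub> y) = f x \<oplus>\<^bsub>N\<^esub> f y"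
    and "\<And>r x. r \<in> carrier R \<Longrightarrow> x \<in> carrier M \<Longrightarrow> f (r \<odot>\<^bsub>M\<^esub> x) = r \<odot>\<^bsub>N\<^esub> f x"
  shows "f \<in> linear_maps R M N"
  using assms by (simp add: linear_maps_def hom_def)

lemma linear_mapsD:
  assumes "f \<in> linear_maps R M N"
  shows "x \<in> carrier M \<Longrightarrow> f x \<in> carrier N"
    and "x \<in> carrier M \<Longrightarrow> y \<in> carrier M \<Longrightarrow> f (x \<oplus>\<^bsub>M\<^esub> y) = f x \<oplus>\<^bsub>N\<^esub> f y"
    and "r \<in> carrier R \<Longrightarrow> x \<in> carrier M \<Longrightarrow> f (r \<odot>\<^bsub>M\<^esub> x) = r \<odot>\<^bsub>N\<^esub> f x"
  using assms by (auto simp: linear_maps_def hom_def)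


lemma (in abelian_group) eq_add_minusI:
  assumes "x \<oplus> y = z" "x \<in> carrier G" "y \<in> carrier G"
  shows "x = z \<oplus> \<ominus> y"
  using assms by (auto simp: a_assoc r_neg)

lemma (in abelian_group) add_minus_cancel4:
  assumes "x \<in> carrier G" "y \<in> carrier G"
  shows "x \<oplus> (y \<oplus> (\<ominus> x \<oplus> \<ominus> y)) = \<zero>"
  using assms by (simp flip: minus_add a_assoc add: r_neg)


subsection \<open>The tensor product is a module with the universal property\<close>

lemma tensor_scale_simps [simp]:
  "tensor_scale M r (frag_of (x, y)) = frag_of (r \<odot>\<^bsub>M\<^esub> x, y)"
  "tensor_scale M r 0 = 0"
  "tensor_scale M r (a + b) = tensor_scale M r a + tensor_scale M r b"
  "tensor_scale M r (a - b) = tensor_scale M r a - tensor_scale M r b"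
  by (simp_all add: tensor_scale_def frag_extend_add frag_extend_diff)

locale two_modules = M: module R M + N: module R N
  for R :: "('k, 'r) ring_scheme" (structure)
    and M :: "('k, 'a, 'm) module_scheme" (structure)
    and N :: "('k, 'b, 'n) module_scheme" (structure)
begin

abbreviation (input) "F \<equiv> tensor_free M N"
abbreviation (input) "H \<equiv> tensor_null R M N"
abbreviation (input) "T \<equiv> tensor_product R M N"

lemma F_comm_group: "comm_group F"
  by (simp add: tensor_free_def abelian_free_Abelian_group)

lemma F_simps [simp]:
  "c \<in> carrier F \<longleftrightarrow> Poly_Mapping.keys c \<subseteq> carrier M \<times> carrier N"
  "c \<otimes>\<^bsub>F\<^esub> d = c + d" "\<one>\<^bsub>F\<^esub> = 0"
  by (simp_all add: tensor_free_def)

lemma F_inv [simp]: "c \<in> carrier F \<Longrightarrow> inv\<^bsub>F\<^esub> c = - c"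
  by (simp add: tensor_free_def)

lemma F_closed:
  "c \<in> carrier F \<Longrightarrow> d \<in> carrier F \<Longrightarrow> c + d \<in> carrier F"
  "c \<in> carrier F \<Longrightarrow> d \<in> carrier F \<Longrightarrow> c - d \<in> carrier F"
  "x \<in> carrier M \<Longrightarrow> y \<in> carrier N \<Longrightarrow> frag_of (x, y) \<in> carrier F"
  "0 \<in> carrier F"
  using keys_add[of c d] keys_diff[of c d] by auto

lemma F_induct [consumes 1, case_names zero diff pure]:
  assumes "c \<in> carrier F" and "P 0"
    and "\<And>c d. c \<in> carrier F \<Longrightarrow> d \<in> carrier F \<Longrightarrow> P c \<Longrightarrow> P d \<Longrightarrow> P (c - d)"
    and "\<And>x y. x \<in> carrier M \<Longrightarrow> y \<in> carrier N \<Longrightarrow> P (frag_of (x, y))"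
  shows "P c"
  by (rule free_Abelian_group_induct[of c "carrier M \<times> carrier N"]) (use assms in auto)

lemma rels_intros:
  "x \<in> carrier M \<Longrightarrow> x' \<in> carrier M \<Longrightarrow> y \<in> carrier N
    \<Longrightarrow> frag_of (x \<oplus>\<^bsub>M\<^esub> x', y) - frag_of (x, y) - frag_of (x', y) \<in> tensor_rels R M N"
  "x \<in> carrier M \<Longrightarrow> y \<in> carrier N \<Longrightarrow> y' \<in> carrier N
    \<Longrightarrow> frag_of (x, y \<oplus>\<^bsub>N\<^esub> y') - frag_of (x, y) - frag_of (x, y') \<in> tensor_rels R M N"
  "r \<in> carrier R \<Longrightarrow> x \<in> carrier M \<Longrightarrow> y \<in> carrier N
    \<Longrightarrow> frag_of (r \<odot>\<^bsub>M\<^esub> x, y) - frag_of (x, r \<odot>\<^bsub>N\<^esub> y) \<in> tensor_rels R M N"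
  unfolding tensor_rels_def by blast+

lemma rels_subset: "tensor_rels R M N \<subseteq> carrier F"
  unfolding tensor_rels_def by (auto simp del: F_simps intro!: F_closed)

lemma H_subgroup: "subgroup H F"
  unfolding tensor_null_def
  by (rule group.generate_is_subgroup) (use F_comm_group rels_subset in \<open>auto simp: comm_group_def\<close>)

lemma H_normal: "H \<lhd> F"
  using F_comm_group H_subgroup by (rule comm_group.subgroup_imp_normal)

lemma H_closed:
  "h \<in> H \<Longrightarrow> h \<in> carrier F" "0 \<in> H"
  "h \<in> H \<Longrightarrow> h' \<in> H \<Longrightarrow> h + h' \<in> H" "h \<in> H \<Longrightarrow> - h \<in> H" "h \<in> H \<Longrightarrow> h' \<in> H \<Longrightarrow> h - h' \<in> H"
  "h \<in> tensor_rels R M N \<Longrightarrow> h \<in> H"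
proof -
  show c: "h \<in> H \<Longrightarrow> h \<in> carrier F" for h
    using subgroup.mem_carrier[OF H_subgroup] by blast
  show "0 \<in> H" using subgroup.one_closed[OF H_subgroup] by simp
  show add: "h \<in> H \<Longrightarrow> h' \<in> H \<Longrightarrow> h + h' \<in> H" for h h'
    using subgroup.m_closed[OF H_subgroup, of h h'] by simp
  show minus: "h \<in> H \<Longrightarrow> - h \<in> H" for h
    using subgroup.m_inv_closed[OF H_subgroup, of h] c[of h] F_inv[of h] by metis
  show "h \<in> H \<Longrightarrow> h' \<in> H \<Longrightarrow> h - h' \<in> H"
    using add[OF _ minus] by (metis diff_conv_add_uminus)
  show "h \<in> tensor_rels R M N \<Longrightarrow> h \<in> H"
    unfolding tensor_null_def by (rule generate.incl)
qed

lemma class_eqI: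
  assumes "c \<in> carrier F" "d \<in> carrier F" "c - d \<in> H"
  shows "tensor_class R M N c = tensor_class R M N d"
proof -
  have "c \<in> H #>\<^bsub>F\<^esub> d"
    using assms(3) by (force simp: r_coset_def)
  then show ?thesis
    unfolding tensor_class_def
    using group.repr_independence[of F c H d] F_comm_group H_subgroup assms(2)
    by (simp add: comm_group_def del: F_simps)
qed

lemma mem_class_iff: "d \<in> tensor_class R M N c \<longleftrightarrow> d - c \<in> H"
  unfolding tensor_class_def r_coset_def by (force simp: algebra_simps)

lemma scale_closed:
  assumes "r \<in> carrier R" "c \<in> carrier F" shows "tensor_scale M r c \<in> carrier F"
  using assms(2)
  by (induction rule: F_induct) (use assms(1) in \<open>auto simp del: F_simps intro!: F_closed\<close>)

lemma scale_H:
  assumes r: "r \<in> carrier R" and "h \<in> H" shows "tensor_scale M r h \<in> H"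
proof -
  have base: "tensor_scale M r h \<in> H" if h: "h \<in> tensor_rels R M N" for h
  proof -
    consider
        (l) x x' y where "h = frag_of (x \<oplus>\<^bsub>M\<^esub> x', y) - frag_of (x, y) - frag_of (x', y)"
          "x \<in> carrier M" "x' \<in> carrier M" "y \<in> carrier N"
      | (r) x y y' where "h = frag_of (x, y \<oplus>\<^bsub>N\<^esub> y') - frag_of (x, y) - frag_of (x, y')"
          "x \<in> carrier M" "y \<in> carrier N" "y' \<in> carrier N"
      | (s) s x y where "h = frag_of (s \<odot>\<^bsub>M\<^esub> x, y) - frag_of (x, s \<odot>\<^bsub>N\<^esub> y)"
          "s \<in> carrier R" "x \<in> carrier M" "y \<in> carrier N"
      using h unfolding tensor_rels_def by blast
    then have "tensor_scale M r h \<in> tensor_rels R M N"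
    proof cases
      case l
      then show ?thesis
        using r rels_intros(1)[of "r \<odot>\<^bsub>M\<^esub> x" "r \<odot>\<^bsub>M\<^esub> x'" y] by (simp add: M.smult_r_distr)
    next
      case (r x y y')
      then show ?thesis
        using assms(1) rels_intros(2)[of "r \<odot>\<^bsub>M\<^esub> x" y y'] by simp
    next
      case (s s x y)
      then have "r \<odot>\<^bsub>M\<^esub> (s \<odot>\<^bsub>M\<^esub> x) = s \<odot>\<^bsub>M\<^esub> (r \<odot>\<^bsub>M\<^esub> x)"
        using assms(1) by (simp add: M.m_comm flip: M.smult_assoc1)
      then show ?thesis
        using s assms(1) rels_intros(3)[of s "r \<odot>\<^bsub>M\<^esub> x" y] by simp
    qed
    then show ?thesis by (rule H_closed)
  qed
  from \<open>h \<in> H\<close> show ?thesis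
    unfolding tensor_null_def
  proof (induction rule: generate.induct)
    case one
    then show ?case using generate.one[of F "tensor_rels R M N"] by simp
  next
    case (incl h)
    then show ?case using base by (simp add: tensor_null_def)
  next
    case (inv h)
    then have "h \<in> carrier F" using rels_subset by blast
    then have "tensor_scale M r (inv\<^bsub>F\<^esub> h) = - tensor_scale M r h"
      using tensor_scale_simps(4)[of M r 0 h] by simp
    then show ?case using H_closed(4) base inv by (simp add: tensor_null_def)
  next
    case (eng h h')
    then show ?case using H_closed(3) by (simp add: tensor_null_def)
  qed
qed

lemma carrier_T: "carrier T = tensor_class R M N ` carrier F"
  by (simp add: tensor_product_def Let_def carrier_FactGroup tensor_class_def[abs_def])

lemma zero_T: "\<zero>\<^bsub>T\<^esub> = tensor_class R M N 0"
proof -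
  have "H #>\<^bsub>F\<^esub> \<one>\<^bsub>F\<^esub> = H"
    using group.coset_mult_one[of F H] F_comm_group H_subgroup
    by (auto simp: comm_group_def dest: subgroup.subset)
  then show ?thesis
    by (simp add: tensor_product_def Let_def tensor_class_def)
qed

lemma add_T:
  assumes "c \<in> carrier F" "d \<in> carrier F"
  shows "tensor_class R M N c \<oplus>\<^bsub>T\<^esub> tensor_class R M N d = tensor_class R M N (c + d)"
  using normal.rcos_sum[OF H_normal assms]
  by (simp add: tensor_product_def Let_def tensor_class_def)

lemma smult_T:
  assumes "r \<in> carrier R" "c \<in> carrier F"
  shows "r \<odot>\<^bsub>T\<^esub> tensor_class R M N c = tensor_class R M N (tensor_scale M r c)"
proof -
  have "tensor_class R M N (tensor_scale M r d) = tensor_class R M N (tensor_scale M r c)"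
    if d: "d \<in> tensor_class R M N c" for d
  proof -
    have h: "d - c \<in> H" using d by (simp add: mem_class_iff)
    then have "d \<in> carrier F" using H_closed(1)[OF h] assms(2) F_closed(1)[of "d - c" c] by simp
    then show ?thesis
      using scale_H[OF assms(1) h] assms scale_closed by (intro class_eqI) auto
  qed
  moreover have "c \<in> tensor_class R M N c" by (simp add: mem_class_iff H_closed)
  ultimately have "(\<lambda>d. tensor_class R M N (tensor_scale M r d)) ` tensor_class R M N c =
      {tensor_class R M N (tensor_scale M r c)}"
    by blast
  then show ?thesis
    by (simp add: tensor_product_def Let_def)
qed

lemma T_comm_group: "comm_group (add_monoid T)"
proof -
  have "comm_group (F Mod H)"
    using comm_group.abelian_FactGroup[OF F_comm_group H_subgroup] .
  moreover have "monoid.truncate (add_monoid T) = F Mod H"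
    by (simp add: tensor_product_def Let_def FactGroup_def monoid.defs)
  ultimately interpret Q: comm_group "monoid.truncate (add_monoid T)" by simp
  show ?thesis
    by (rule comm_groupI)
      (use Q.m_closed Q.one_closed Q.m_assoc Q.m_comm Q.l_one Q.l_inv_ex in \<open>auto simp: monoid.defs\<close>)
qed

lemma scale_add_H:
  assumes "a \<in> carrier R" "b \<in> carrier R" "c \<in> carrier F"
  shows "tensor_scale M (a \<oplus> b) c - (tensor_scale M a c + tensor_scale M b c) \<in> H"
  using assms(3)
proof (induction rule: F_induct)
  case zero then show ?case by (simp add: H_closed)
next
  case (diff c d)
  from H_closed(5)[OF diff(3,4)] show ?case by (simp add: algebra_simps)
next
  case (pure x y)
  then have "tensor_scale M (a \<oplus> b) (frag_of (x, y))
      - (tensor_scale M a (frag_of (x, y)) + tensor_scale M b (frag_of (x, y)))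
     = frag_of (a \<odot>\<^bsub>M\<^esub> x \<oplus>\<^bsub>M\<^esub> b \<odot>\<^bsub>M\<^esub> x, y) - frag_of (a \<odot>\<^bsub>M\<^esub> x, y) - frag_of (b \<odot>\<^bsub>M\<^esub> x, y)"
    using assms by (simp add: M.smult_l_distr algebra_simps)
  also have "\<dots> \<in> H"
    using pure assms by (intro H_closed(6) rels_intros) auto
  finally show ?case .
qed

lemma scale_scale:
  assumes "a \<in> carrier R" "b \<in> carrier R" "c \<in> carrier F"
  shows "tensor_scale M (a \<otimes> b) c = tensor_scale M a (tensor_scale M b c)"
  using assms(3) by (induction rule: F_induct) (use assms in \<open>auto simp: M.smult_assoc1\<close>)

lemma scale_one: "c \<in> carrier F \<Longrightarrow> tensor_scale M \<one> c = c"
  by (induction rule: F_induct) auto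

theorem module_tensor_product: "module R T"
proof (rule moduleI)
  show "cring R" by (rule M.is_cring)
  show "abelian_group T"
    using T_comm_group
    by (intro abelian_group.intro abelian_monoid.intro abelian_group_axioms.intro)
      (auto simp: comm_group_def)
next
  fix a X assume a: "a \<in> carrier R" and X: "X \<in> carrier T"
  then obtain c where c: "c \<in> carrier F" "X = tensor_class R M N c"
    by (auto simp only: carrier_T)
  show "a \<odot>\<^bsub>T\<^esub> X \<in> carrier T"
    using scale_closed[OF a c(1)] a c by (auto simp only: smult_T carrier_T)
next
  fix a b X assume a: "a \<in> carrier R" and b: "b \<in> carrier R" and X: "X \<in> carrier T"
  then obtain c where c: "c \<in> carrier F" "X = tensor_class R M N c"
    by (auto simp only: carrier_T)
  show "(a \<oplus> b) \<odot>\<^bsub>T\<^esub> X = a \<odot>\<^bsub>T\<^esub> X \<oplus>\<^bsub>T\<^esub> b \<odot>\<^bsub>T\<^esub> X"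
    using class_eqI[OF _ _ scale_add_H[OF a b c(1)]] scale_closed[OF a c(1)] scale_closed[OF b c(1)]
      scale_closed[of "a \<oplus> b", OF _ c(1)] F_closed(1) a b c
    by (simp add: smult_T add_T del: F_simps)
  show "a \<otimes> b \<odot>\<^bsub>T\<^esub> X = a \<odot>\<^bsub>T\<^esub> (b \<odot>\<^bsub>T\<^esub> X)"
    using scale_closed[OF b c(1)] a b c
    by (simp add: smult_T scale_scale del: F_simps)
next
  fix a X Y assume a: "a \<in> carrier R" and X: "X \<in> carrier T" and Y: "Y \<in> carrier T"
  then obtain c d where c: "c \<in> carrier F" "X = tensor_class R M N c"
    and d: "d \<in> carrier F" "Y = tensor_class R M N d"
    by (auto simp only: carrier_T)
  show "a \<odot>\<^bsub>T\<^esub> (X \<oplus>\<^bsub>T\<^esub> Y) = a \<odot>\<^bsub>T\<^esub> X \<oplus>\<^bsub>T\<^esub> a \<odot>\<^bsub>T\<^esub> Y"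
    using scale_closed[OF a c(1)] scale_closed[OF a d(1)] F_closed(1) a c d
    by (simp add: smult_T add_T del: F_simps)
next
  fix X assume "X \<in> carrier T"
  then obtain c where c: "c \<in> carrier F" "X = tensor_class R M N c"
    by (auto simp only: carrier_T)
  show "\<one> \<odot>\<^bsub>T\<^esub> X = X"
    using c by (simp add: smult_T scale_one del: F_simps)
qed

lemma pure_tensor_closed:
  "x \<in> carrier M \<Longrightarrow> y \<in> carrier N \<Longrightarrow> pure_tensor R M N x y \<in> carrier T"
  using F_closed(3) by (auto simp only: pure_tensor_def carrier_T)

lemma pure_tensor_add_left:
  assumes "x \<in> carrier M" "x' \<in> carrier M" "y \<in> carrier N"
  shows "pure_tensor R M N (x \<oplus>\<^bsub>M\<^esub> x') y = pure_tensor R M N x y \<oplus>\<^bsub>T\<^esub> pure_tensor R M N x' y"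
proof -
  have "frag_of (x \<oplus>\<^bsub>M\<^esub> x', y) - (frag_of (x, y) + frag_of (x', y)) \<in> H"
    using H_closed(6)[OF rels_intros(1)[OF assms]] by (simp add: algebra_simps)
  from class_eqI[OF _ _ this] show ?thesis
    using assms F_closed(1,3) by (simp add: pure_tensor_def add_T del: F_simps)
qed

lemma pure_tensor_add_right:
  assumes "x \<in> carrier M" "y \<in> carrier N" "y' \<in> carrier N"
  shows "pure_tensor R M N x (y \<oplus>\<^bsub>N\<^esub> y') = pure_tensor R M N x y \<oplus>\<^bsub>T\<^esub> pure_tensor R M N x y'"
proof -
  have "frag_of (x, y \<oplus>\<^bsub>N\<^esub> y') - (frag_of (x, y) + frag_of (x, y')) \<in> H"
    using H_closed(6)[OF rels_intros(2)[OF assms]] by (simp add: algebra_simps)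
  from class_eqI[OF _ _ this] show ?thesis
    using assms F_closed(1,3) by (simp add: pure_tensor_def add_T del: F_simps)
qed

lemma pure_tensor_smult:
  assumes "r \<in> carrier R" "x \<in> carrier M" "y \<in> carrier N"
  shows "pure_tensor R M N (r \<odot>\<^bsub>M\<^esub> x) y = r \<odot>\<^bsub>T\<^esub> pure_tensor R M N x y"
    and "pure_tensor R M N x (r \<odot>\<^bsub>N\<^esub> y) = r \<odot>\<^bsub>T\<^esub> pure_tensor R M N x y"
proof -
  show *: "pure_tensor R M N (r \<odot>\<^bsub>M\<^esub> x) y = r \<odot>\<^bsub>T\<^esub> pure_tensor R M N x y"
    using assms F_closed(3) by (simp add: pure_tensor_def smult_T del: F_simps)
  have "pure_tensor R M N (r \<odot>\<^bsub>M\<^esub> x) y = pure_tensor R M N x (r \<odot>\<^bsub>N\<^esub> y)"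
    using assms F_closed(3) class_eqI[OF _ _ H_closed(6)[OF rels_intros(3)[OF assms]]]
    by (simp add: pure_tensor_def del: F_simps)
  with * show "pure_tensor R M N x (r \<odot>\<^bsub>N\<^esub> y) = r \<odot>\<^bsub>T\<^esub> pure_tensor R M N x y" by simp
qed

theorem bilinear_pure_tensor: "bilinear_map R M N T (pure_tensor R M N)"
  unfolding bilinear_map_def
  by (intro conjI ballI linear_mapsI pure_tensor_closed pure_tensor_add_left pure_tensor_add_right
      pure_tensor_smult)

theorem linear_maps_tensor_eqI:
  assumes P: "module R P"
    and g: "g \<in> linear_maps R T P" and h: "h \<in> linear_maps R T P"
    and eq: "\<And>x y. x \<in> carrier M \<Longrightarrow> y \<in> carrier N \<Longrightarrow>
      g (pure_tensor R M N x y) = h (pure_tensor R M N x y)"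
    and "t \<in> carrier T"
  shows "g t = h t"
proof -
  interpret P: module R P by fact
  interpret T: module R T by (rule module_tensor_product)
  have sub: "tensor_class R M N (c - d) = tensor_class R M N c \<oplus>\<^bsub>T\<^esub> (\<ominus> \<one>) \<odot>\<^bsub>T\<^esub> tensor_class R M N d"
    if cd: "c \<in> carrier F" "d \<in> carrier F" for c d
  proof -
    have cl: "tensor_class R M N c \<in> carrier T" "tensor_class R M N d \<in> carrier T"
      "tensor_class R M N (c - d) \<in> carrier T"
      using cd F_closed(2)[OF cd] by (auto simp only: carrier_T)
    have "tensor_class R M N (c - d) \<oplus>\<^bsub>T\<^esub> tensor_class R M N d = tensor_class R M N c"
      using cd F_closed(2)[OF cd] by (simp add: add_T del: F_simps)
    then show ?thesis
      using cl by (simp add: T.smult_l_minus T.M.eq_add_minusI[of _ "tensor_class R M N d"])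
  qed
  obtain c where c: "c \<in> carrier F" "t = tensor_class R M N c"
    using \<open>t \<in> carrier T\<close> by (auto simp only: carrier_T)
  have "g (tensor_class R M N c) = h (tensor_class R M N c)"
    using c(1)
  proof (induction rule: F_induct)
    case zero
    have "k \<zero>\<^bsub>T\<^esub> = \<zero>\<^bsub>P\<^esub>" if k: "k \<in> linear_maps R T P" for k
      using linear_mapsD(1)[OF k, of "\<zero>\<^bsub>T\<^esub>"] linear_mapsD(3)[OF k, of \<zero> "\<zero>\<^bsub>T\<^esub>"] by simp
    from this[OF g] this[OF h] have "g \<zero>\<^bsub>T\<^esub> = h \<zero>\<^bsub>T\<^esub>" by simp
    then show ?case by (simp add: zero_T)
  next
    case (diff c d)
    have "tensor_class R M N c \<in> carrier T" "tensor_class R M N d \<in> carrier T"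
      using diff by (auto simp only: carrier_T)
    then show ?case
      using diff by (simp add: sub linear_mapsD[OF g] linear_mapsD[OF h] del: F_simps)
  next
    case (pure x y)
    then show ?case using eq by (simp add: pure_tensor_def)
  qed
  with c show ?thesis by simp
qed

theorem tensor_lift:
  assumes P: "module R P" and f: "bilinear_map R M N P f"
  shows "tensor_lift R M N P f \<in> linear_maps R T P"
    and "\<And>x y. x \<in> carrier M \<Longrightarrow> y \<in> carrier N \<Longrightarrow>
      tensor_lift R M N P f (pure_tensor R M N x y) = f x y"
proof -
  interpret P: module R P by fact
  interpret T: module R T by (rule module_tensor_product)
  have fl: "x \<in> carrier M \<Longrightarrow> f x \<in> linear_maps R N P"
    and fr: "y \<in> carrier N \<Longrightarrow> (\<lambda>x. f x y) \<in> linear_maps R M P" for x y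
    using f by (auto simp: bilinear_map_def)
  note fl = linear_mapsD[OF fl] and fr = linear_mapsD[OF fr]
  have Pg: "comm_group (add_monoid P)" by (rule P.a_comm_group)
  have img: "(\<lambda>(x, y). f x y) ` (carrier M \<times> carrier N) \<subseteq> carrier (add_monoid P)"
    using fl(1) by auto
  obtain h where h: "h \<in> hom F (add_monoid P)"
    and hf: "\<And>x y. x \<in> carrier M \<Longrightarrow> y \<in> carrier N \<Longrightarrow> h (frag_of (x, y)) = f x y"
    using comm_group.free_Abelian_group_universal[OF Pg img] unfolding tensor_free_def
    by (metis (no_types, lifting) SigmaI case_prod_conv)
  interpret h: group_hom F "add_monoid P" h
    using h F_comm_group Pg by (simp add: group_hom_def group_hom_axioms_def comm_group_def)
  have h_add: "h (c + d) = h c \<oplus>\<^bsub>P\<^esub> h d" if "c \<in> carrier F" "d \<in> carrier F" for c d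
    using h.hom_mult[OF that] by simp
  have h_cl: "h c \<in> carrier P" if "c \<in> carrier F" for c
    using h.hom_closed[OF that] by simp
  have h_diff: "h (c - d) = h c \<ominus>\<^bsub>P\<^esub> h d" if "c \<in> carrier F" "d \<in> carrier F" for c d
  proof -
    have "h (c - d) \<oplus>\<^bsub>P\<^esub> h d = h c"
      using h_add[OF F_closed(2)[OF that] that(2)] by simp
    then show ?thesis
      using h_cl F_closed(2)[OF that] that
      by (simp add: P.minus_eq P.M.eq_add_minusI del: F_simps)
  qed
  have "tensor_rels R M N \<subseteq> kernel F (add_monoid P) h"
  proof
    fix c assume c: "c \<in> tensor_rels R M N"
    then have "h c = \<zero>\<^bsub>P\<^esub>"
      unfolding tensor_rels_def
      by (elim UnE CollectE exE conjE)
        (simp_all add: h_diff F_closed hf fl fr P.minus_eq P.r_neg P.minus_add P.a_ac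
          P.M.add_minus_cancel4 del: F_simps)
    then show "c \<in> kernel F (add_monoid P) h"
      using c rels_subset by (auto simp: kernel_def simp del: F_simps)
  qed
  then have "H \<subseteq> kernel F (add_monoid P) h"
    unfolding tensor_null_def by (intro h.generate_subgroup_incl h.subgroup_kernel)
  then obtain g where g: "g \<in> hom (F Mod H) (add_monoid P)"
    and gh: "\<And>c. c \<in> carrier F \<Longrightarrow> g (H #>\<^bsub>F\<^esub> c) = h c"
    using h.FactGroup_universal_kernel[OF H_normal] by blast
  have h_scale: "h (tensor_scale M r c) = r \<odot>\<^bsub>P\<^esub> h c" if r: "r \<in> carrier R" and c: "c \<in> carrier F" for r c
    using c
  proof (induction rule: F_induct)
    case zero
    have "h 0 = \<zero>\<^bsub>P\<^esub>" using h.hom_one by simp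
    then show ?case using r by simp
  next
    case (diff c d)
    have "h (tensor_scale M r (c - d)) = h (tensor_scale M r c) \<ominus>\<^bsub>P\<^esub> h (tensor_scale M r d)"
      using h_diff[OF scale_closed[OF r diff(1)] scale_closed[OF r diff(2)]] by simp
    also have "\<dots> = r \<odot>\<^bsub>P\<^esub> h c \<oplus>\<^bsub>P\<^esub> r \<odot>\<^bsub>P\<^esub> (\<ominus>\<^bsub>P\<^esub> h d)"
      using diff(3,4) r h_cl[OF diff(2)] by (simp only: P.minus_eq P.smult_r_minus)
    also have "\<dots> = r \<odot>\<^bsub>P\<^esub> h (c - d)"
      using r h_cl[OF diff(1)] h_cl[OF diff(2)]
      by (simp only: h_diff[OF diff(1,2)] P.minus_eq P.smult_r_distr P.M.a_inv_closed)
    finally show ?case .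
  next
    case (pure x y)
    then show ?case using r hf[of x y] hf[of "r \<odot>\<^bsub>M\<^esub> x" y] fr(3)[of y r x] by simp
  qed
  have g_lin: "g \<in> linear_maps R T P"
  proof -
    have "g \<in> hom (add_monoid T) (add_monoid P)"
      using g by (simp add: tensor_product_def Let_def hom_def)
    moreover have "g (r \<odot>\<^bsub>T\<^esub> t) = r \<odot>\<^bsub>P\<^esub> g t" if r: "r \<in> carrier R" and t: "t \<in> carrier T" for r t
    proof -
      obtain c where c: "c \<in> carrier F" "t = tensor_class R M N c"
        using t by (auto simp only: carrier_T)
      then show ?thesis
        using r gh[folded tensor_class_def] scale_closed[OF r c(1)] h_scale
        by (simp add: smult_T del: F_simps)
    qed
    ultimately show ?thesis by (simp add: linear_maps_def)
  qed
  have g_pure: "g (pure_tensor R M N x y) = f x y" if "x \<in> carrier M" "y \<in> carrier N" for x y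
    using that gh[OF F_closed(3)] hf by (simp add: pure_tensor_def tensor_class_def)
  let ?Q = "\<lambda>h. h \<in> extensional (carrier T) \<and> h \<in> linear_maps R T P \<and>
       (\<forall>x\<in>carrier M. \<forall>y\<in>carrier N. h (pure_tensor R M N x y) = f x y)"
  have "restrict g (carrier T) \<in> linear_maps R T P"
    by (rule linear_mapsI) (simp_all add: linear_mapsD[OF g_lin])
  then have Q: "?Q (restrict g (carrier T))"
    by (simp add: g_pure pure_tensor_closed)
  have uniq: "k = restrict g (carrier T)" if k: "?Q k" for k
  proof (rule extensionalityI)
    show "k \<in> extensional (carrier T)" using k by (rule conjunct1)
    show "restrict g (carrier T) \<in> extensional (carrier T)" by (rule restrict_extensional)
    have k_lin: "k \<in> linear_maps R T P" using k by blast
    have k_pure: "k (pure_tensor R M N x y) = g (pure_tensor R M N x y)"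
      if "x \<in> carrier M" "y \<in> carrier N" for x y
      using k g_pure[OF that] that by simp
    fix t assume t: "t \<in> carrier T"
    show "k t = restrict g (carrier T) t"
      using linear_maps_tensor_eqI[OF P k_lin g_lin k_pure t] t by simp
  qed
  have "?Q (tensor_lift R M N P f)"
    unfolding tensor_lift_def by (rule theI[of ?Q, OF Q uniq])
  then show "tensor_lift R M N P f \<in> linear_maps R T P"
    and "\<And>x y. x \<in> carrier M \<Longrightarrow> y \<in> carrier N \<Longrightarrow>
      tensor_lift R M N P f (pure_tensor R M N x y) = f x y"
    by auto
qed

end


subsection \<open>Structural maps\<close>

definition tensor_map ::
  "('k, 'r) ring_scheme \<Rightarrow> ('k, 'a, 'm) module_scheme \<Rightarrow> ('k, 'b, 'n) module_scheme
    \<Rightarrow> ('k, 'c, 'p) module_scheme \<Rightarrow> ('k, 'd, 'q) module_scheme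
    \<Rightarrow> ('a \<Rightarrow> 'c) \<Rightarrow> ('b \<Rightarrow> 'd) \<Rightarrow> ('a, 'b) tensor \<Rightarrow> ('c, 'd) tensor"
  where "tensor_map R A B C D f g =
    tensor_lift R A B (tensor_product R C D) (\<lambda>a b. pure_tensor R C D (f a) (g b))"

definition tensor_flip ::
  "('k, 'r) ring_scheme \<Rightarrow> ('k, 'a, 'm) module_scheme \<Rightarrow> ('k, 'b, 'n) module_scheme
    \<Rightarrow> ('a, 'b) tensor \<Rightarrow> ('b, 'a) tensor"
  where "tensor_flip R A B =
    tensor_lift R A B (tensor_product R B A) (\<lambda>a b. pure_tensor R B A b a)"

definition tensor_assoc ::
  "('k, 'r) ring_scheme \<Rightarrow> ('k, 'a, 'm) module_scheme \<Rightarrow> ('k, 'b, 'n) module_scheme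
    \<Rightarrow> ('k, 'c, 'p) module_scheme \<Rightarrow> (('a, 'b) tensor, 'c) tensor \<Rightarrow> ('a, ('b, 'c) tensor) tensor"
  where "tensor_assoc R A B C =
    (let BC = tensor_product R B C; T = tensor_product R A BC in
     tensor_lift R (tensor_product R A B) C T
       (\<lambda>s c. tensor_lift R A B T (\<lambda>a b. pure_tensor R A BC a (pure_tensor R B C b c)) s))"

definition tensor_assoc_inv ::
  "('k, 'r) ring_scheme \<Rightarrow> ('k, 'a, 'm) module_scheme \<Rightarrow> ('k, 'b, 'n) module_scheme
    \<Rightarrow> ('k, 'c, 'p) module_scheme \<Rightarrow> ('a, ('b, 'c) tensor) tensor \<Rightarrow> (('a, 'b) tensor, 'c) tensor"
  where "tensor_assoc_inv R A B C =
    (let AB = tensor_product R A B; T = tensor_product R AB C in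
     tensor_lift R A (tensor_product R B C) T
       (\<lambda>a s. tensor_lift R B C T (\<lambda>b c. pure_tensor R AB C (pure_tensor R A B a b) c) s))"

text \<open>The map \<open>1 \<otimes> \<tau> \<otimes> 1\<close> from \<open>(A \<otimes> B) \<otimes> (C \<otimes> D)\<close> to \<open>(A \<otimes> C) \<otimes> (B \<otimes> D)\<close>, with the associativity
  isomorphisms made explicit.\<close>

definition tensor_mid_flip ::
  "('k, 'r) ring_scheme \<Rightarrow> ('k, 'a, 'm) module_scheme \<Rightarrow> ('k, 'b, 'n) module_scheme
    \<Rightarrow> ('k, 'c, 'p) module_scheme \<Rightarrow> ('k, 'd, 'q) module_scheme
    \<Rightarrow> (('a, 'b) tensor, ('c, 'd) tensor) tensor \<Rightarrow> (('a, 'c) tensor, ('b, 'd) tensor) tensor"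
  where "tensor_mid_flip R A B C D =
    tensor_assoc_inv R A C (tensor_product R B D) \<circ>
    tensor_map R A (tensor_product R B (tensor_product R C D))
      A (tensor_product R C (tensor_product R B D)) id
      (tensor_assoc R C B D \<circ>
       tensor_map R (tensor_product R B C) D (tensor_product R C B) D (tensor_flip R B C) id \<circ>
       tensor_assoc_inv R B C D) \<circ>
    tensor_assoc R A B (tensor_product R C D)"


section \<open>Coalgebras and shelves\<close>

locale coalgebra = module R C
  for R :: "('k, 'r) ring_scheme" (structure) and C :: "('k, 'c, 'm) module_scheme" (structure) +
  fixes comult :: "'c \<Rightarrow> ('c, 'c) tensor" and counit :: "'c \<Rightarrow> 'k"
  assumes comult_linear: "comult \<in> linear_maps R C (tensor_product R C C)"
    and counit_linear: "counit \<in> linear_maps R C (base_module R)"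
    and coassociative: "x \<in> carrier C \<Longrightarrow>
      tensor_assoc R C C C (tensor_map R C C (tensor_product R C C) C comult id (comult x)) =
      tensor_map R C C C (tensor_product R C C) id comult (comult x)"
    and counit_left: "x \<in> carrier C \<Longrightarrow>
      tensor_lift R (base_module R) C C (\<lambda>r y. r \<odot>\<^bsub>C\<^esub> y)
        (tensor_map R C C (base_module R) C counit id (comult x)) = x"
    and counit_right: "x \<in> carrier C \<Longrightarrow>
      tensor_lift R C (base_module R) C (\<lambda>y r. r \<odot>\<^bsub>C\<^esub> y)
        (tensor_map R C C C (base_module R) id counit (comult x)) = x"

locale cocommutative_coalgebra = coalgebra +
  assumes cocommutative: "x \<in> carrier C \<Longrightarrow> tensor_flip R C C (comult x) = comult x"

definition self_distributive ::
  "('k, 'r) ring_scheme \<Rightarrow> ('k, 'c, 'm) module_scheme \<Rightarrow> ('c \<Rightarrow> ('c, 'c) tensor)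
    \<Rightarrow> (('c, 'c) tensor \<Rightarrow> 'c) \<Rightarrow> bool"
  where "self_distributive R C comult q \<longleftrightarrow>
    (let CC = tensor_product R C C in
     \<forall>t\<in>carrier (tensor_product R CC C).
       (q \<circ> tensor_map R CC C C C q id) t =
       (q \<circ> tensor_map R CC CC C C q q \<circ> tensor_mid_flip R C C C C \<circ>
        tensor_map R CC C CC CC (tensor_map R C C C C id id) comult) t)"

text \<open>A coalgebra morphism from \<open>C \<otimes> C\<close> to \<open>C\<close>, where \<open>C \<otimes> C\<close> carries the tensor product coalgebra
  structure; the identification of \<open>k \<otimes> k\<close> with \<open>k\<close> is by multiplication.\<close>

definition coalgebra_morphism_op ::
  "('k, 'r) ring_scheme \<Rightarrow> ('k, 'c, 'm) module_scheme \<Rightarrow> ('c \<Rightarrow> ('c, 'c) tensor) \<Rightarrow> ('c \<Rightarrow> 'k)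
    \<Rightarrow> (('c, 'c) tensor \<Rightarrow> 'c) \<Rightarrow> bool"
  where "coalgebra_morphism_op R C comult counit q \<longleftrightarrow>
    (let CC = tensor_product R C C; k = base_module R in
     q \<in> linear_maps R CC C \<and>
     (\<forall>t\<in>carrier CC.
       (comult \<circ> q) t =
       (tensor_map R CC CC C C q q \<circ> tensor_mid_flip R C C C C \<circ>
        tensor_map R C C CC CC comult comult) t) \<and>
     (\<forall>t\<in>carrier CC.
       (counit \<circ> q) t =
       (tensor_lift R k k k (\<lambda>r s. r \<otimes>\<^bsub>R\<^esub> s) \<circ> tensor_map R C C k k counit counit) t))"

locale cocommutative_coalgebra_shelf = cocommutative_coalgebra +
  fixes q :: "('c, 'c) tensor \<Rightarrow> 'c"
  assumes coalgebra_morphism: "coalgebra_morphism_op R C comult counit q"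
    and self_distributive: "self_distributive R C comult q"


section \<open>Lie algebras\<close>

text \<open>The characteristic is the additive order of \<open>1\<close>, which \<^const>\<open>group.ord\<close> sets to \<open>0\<close> if it
  is infinite.\<close>

definition ring_char :: "('k, 'r) ring_scheme \<Rightarrow> nat"
  where "ring_char R = group.ord (add_monoid R) \<one>\<^bsub>R\<^esub>"

locale lie_algebra = K: field K + module K L
  for K :: "('k, 'r) ring_scheme" (structure) and L :: "('k, 'g, 'm) module_scheme" (structure) +
  fixes bracket :: "'g \<Rightarrow> 'g \<Rightarrow> 'g"
  assumes bracket_bilinear: "bilinear_map K L L L bracket"
    and bracket_self: "x \<in> carrier L \<Longrightarrow> bracket x x = \<zero>\<^bsub>L\<^esub>"
    and jacobi: "x \<in> carrier L \<Longrightarrow> y \<in> carrier L \<Longrightarrow> z \<in> carrier L \<Longrightarrow>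
      bracket x (bracket y z) \<oplus>\<^bsub>L\<^esub> bracket y (bracket z x) \<oplus>\<^bsub>L\<^esub> bracket z (bracket x y) = \<zero>\<^bsub>L\<^esub>"

text \<open>An element \<open>a + x\<close> of \<open>k \<oplus> \<gg>\<close> is the pair \<open>(a, x)\<close>.\<close>

definition lie_coalg ::
  "('k, 'r) ring_scheme \<Rightarrow> ('k, 'g, 'm) module_scheme \<Rightarrow> ('k, 'k \<times> 'g) module"
  where "lie_coalg K L = direct_sum (base_module K) L"

definition lie_comult ::
  "('k, 'r) ring_scheme \<Rightarrow> ('k, 'g, 'm) module_scheme
    \<Rightarrow> 'k \<times> 'g \<Rightarrow> ('k \<times> 'g, 'k \<times> 'g) tensor"
  where "lie_comult K L =
    (let N = lie_coalg K L; NN = tensor_product K N N; tens = pure_tensor K N N;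
         e = (\<one>\<^bsub>K\<^esub>, \<zero>\<^bsub>L\<^esub>) in
     (\<lambda>(a, x). a \<odot>\<^bsub>NN\<^esub> tens e e \<oplus>\<^bsub>NN\<^esub> (tens (\<zero>\<^bsub>K\<^esub>, x) e \<oplus>\<^bsub>NN\<^esub> tens e (\<zero>\<^bsub>K\<^esub>, x))))"

definition lie_counit :: "'k \<times> 'g \<Rightarrow> 'k"
  where "lie_counit = (\<lambda>(a, x). a)"

definition lie_shelf_op ::
  "('k, 'r) ring_scheme \<Rightarrow> ('k, 'g, 'm) module_scheme \<Rightarrow> ('g \<Rightarrow> 'g \<Rightarrow> 'g)
    \<Rightarrow> ('k \<times> 'g, 'k \<times> 'g) tensor \<Rightarrow> 'k \<times> 'g"
  where "lie_shelf_op K L bracket =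
    (let N = lie_coalg K L in
     tensor_lift K N N N
       (\<lambda>(a, x) (b, y). (a \<otimes>\<^bsub>K\<^esub> b, b \<odot>\<^bsub>L\<^esub> x \<oplus>\<^bsub>L\<^esub> bracket x y)))"

lemma (in cring) module_base_module: "module R (base_module R)"
proof (rule moduleI)
  show "cring R" by (rule is_cring)
  show "abelian_group (base_module R)"
  proof (rule abelian_groupI)
    fix x assume "x \<in> carrier (base_module R)"
    then show "\<exists>y\<in>carrier (base_module R). y \<oplus>\<^bsub>base_module R\<^esub> x = \<zero>\<^bsub>base_module R\<^esub>"
      by (intro bexI[of _ "\<ominus> x"]) (auto simp: base_module_def l_neg)
  qed (simp_all add: base_module_def a_ac)
qed (simp_all add: base_module_def l_distr r_distr m_assoc)

context two_modules begin

lemma module_direct_sum: "module R (direct_sum M N)"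
proof (rule moduleI)
  show "cring R" by (rule M.is_cring)
  show "abelian_group (direct_sum M N)"
  proof (rule abelian_groupI)
    fix x assume "x \<in> carrier (direct_sum M N)"
    then show "\<exists>y\<in>carrier (direct_sum M N). y \<oplus>\<^bsub>direct_sum M N\<^esub> x = \<zero>\<^bsub>direct_sum M N\<^esub>"
      by (intro bexI[of _ "(\<ominus>\<^bsub>M\<^esub> fst x, \<ominus>\<^bsub>N\<^esub> snd x)"])
        (auto simp: direct_sum_def M.M.l_neg N.M.l_neg)
  qed (auto simp: direct_sum_def M.M.a_ac N.M.a_ac)
next
  fix a x y assume "a \<in> carrier R" "x \<in> carrier (direct_sum M N)" "y \<in> carrier (direct_sum M N)"
  then show "a \<odot>\<^bsub>direct_sum M N\<^esub> (x \<oplus>\<^bsub>direct_sum M N\<^esub> y) =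
      a \<odot>\<^bsub>direct_sum M N\<^esub> x \<oplus>\<^bsub>direct_sum M N\<^esub> a \<odot>\<^bsub>direct_sum M N\<^esub> y"
    by (cases x; cases y) (simp add: direct_sum_def M.smult_r_distr N.smult_r_distr)
next
  fix a b x assume "a \<in> carrier R" "b \<in> carrier R" "x \<in> carrier (direct_sum M N)"
  then show "(a \<oplus> b) \<odot>\<^bsub>direct_sum M N\<^esub> x =
      a \<odot>\<^bsub>direct_sum M N\<^esub> x \<oplus>\<^bsub>direct_sum M N\<^esub> b \<odot>\<^bsub>direct_sum M N\<^esub> x"
    and "a \<otimes> b \<odot>\<^bsub>direct_sum M N\<^esub> x =
      a \<odot>\<^bsub>direct_sum M N\<^esub> (b \<odot>\<^bsub>direct_sum M N\<^esub> x)"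
    by (cases x; simp add: direct_sum_def M.smult_l_distr N.smult_l_distr M.smult_assoc1 N.smult_assoc1)+
qed (auto simp: direct_sum_def)

end

context lie_algebra begin

lemma bracket_simps:
  assumes "x \<in> carrier L" "y \<in> carrier L"
  shows "bracket x y \<in> carrier L"
    and "z \<in> carrier L \<Longrightarrow> bracket (x \<oplus>\<^bsub>L\<^esub> y) z = bracket x z \<oplus>\<^bsub>L\<^esub> bracket y z"
    and "z \<in> carrier L \<Longrightarrow> bracket z (x \<oplus>\<^bsub>L\<^esub> y) = bracket z x \<oplus>\<^bsub>L\<^esub> bracket z y"
    and "r \<in> carrier K \<Longrightarrow> bracket (r \<odot>\<^bsub>L\<^esub> x) y = r \<odot>\<^bsub>L\<^esub> bracket x y"
    and "r \<in> carrier K \<Longrightarrow> bracket x (r \<odot>\<^bsub>L\<^esub> y) = r \<odot>\<^bsub>L\<^esub> bracket x y"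
  using bracket_bilinear assms by (auto simp: bilinear_map_def linear_maps_def hom_def)

lemma smult_lcomm:
  assumes "a \<in> carrier K" "b \<in> carrier K" "x \<in> carrier L"
  shows "a \<odot>\<^bsub>L\<^esub> (b \<odot>\<^bsub>L\<^esub> x) = b \<odot>\<^bsub>L\<^esub> (a \<odot>\<^bsub>L\<^esub> x)"
  using assms by (metis K.m_comm smult_assoc1)

lemma module_lie_coalg: "module K (lie_coalg K L)"
  unfolding lie_coalg_def
  by (intro two_modules.module_direct_sum two_modules.intro K.module_base_module module_axioms)

lemma lie_shelf_op:
  "lie_shelf_op K L bracket \<in>
    linear_maps K (tensor_product K (lie_coalg K L) (lie_coalg K L)) (lie_coalg K L)"
  "a \<in> carrier K \<Longrightarrow> x \<in> carrier L \<Longrightarrow> b \<in> carrier K \<Longrightarrow> y \<in> carrier L \<Longrightarrow>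
    lie_shelf_op K L bracket (pure_tensor K (lie_coalg K L) (lie_coalg K L) (a, x) (b, y)) =
    (a \<otimes>\<^bsub>K\<^esub> b, b \<odot>\<^bsub>L\<^esub> x \<oplus>\<^bsub>L\<^esub> bracket x y)"
proof -
  let ?N = "lie_coalg K L"
  have "bilinear_map K ?N ?N ?N (\<lambda>(a, x) (b, y). (a \<otimes>\<^bsub>K\<^esub> b, b \<odot>\<^bsub>L\<^esub> x \<oplus>\<^bsub>L\<^esub> bracket x y))"
    unfolding bilinear_map_def lie_coalg_def direct_sum_def base_module_def
    by (intro conjI ballI linear_mapsI)
      (clarsimp simp: bracket_simps K.l_distr K.r_distr K.m_assoc K.m_lcomm smult_l_distr
        smult_r_distr smult_assoc1 smult_lcomm M.a_assoc M.a_lcomm)+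
  note lift = two_modules.tensor_lift[OF two_modules.intro[OF module_lie_coalg module_lie_coalg]
      module_lie_coalg this]
  show "lie_shelf_op K L bracket \<in> linear_maps K (tensor_product K ?N ?N) ?N"
    using lift(1) by (simp add: lie_shelf_op_def Let_def)
  show "lie_shelf_op K L bracket (pure_tensor K ?N ?N (a, x) (b, y)) =
      (a \<otimes>\<^bsub>K\<^esub> b, b \<odot>\<^bsub>L\<^esub> x \<oplus>\<^bsub>L\<^esub> bracket x y)"
    if "a \<in> carrier K" "x \<in> carrier L" "b \<in> carrier K" "y \<in> carrier L"
    using lift(2)[of "(a, x)" "(b, y)"] that
    by (simp add: lie_shelf_op_def Let_def lie_coalg_def direct_sum_def base_module_def)
qed

end

end

theory Submission
  imports Defs
begin

text \<open>Every identity to be proved compares two linear maps built from \<open>q\<close>, \<open>\<Delta>\<close>, \<open>\<epsilon>\<close> and the structural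
  maps of tensor products. Such maps agree as soon as they agree on pure tensors, and in each factor
  \<open>N = k \<oplus> \<gg>\<close> only the unit \<open>e = (1, 0)\<close> and the elements \<open>x = (0, x)\<close> of \<open>\<gg>\<close> have to be tested. On
  these, \<open>\<Delta> e = e \<otimes> e\<close> and \<open>\<Delta> x = x \<otimes> e + e \<otimes> x\<close>, while \<open>q\<close> is given by
  \<open>q (u \<otimes> e) = u\<close>, \<open>q (e \<otimes> y) = 0\<close> and \<open>q (x \<otimes> y) = [x, y]\<close>.

  Compatibility with \<open>\<Delta>\<close> is then a comparison of few terms. The only case with content is \<open>x \<otimes> y\<close>:
  expanding \<open>\<Delta> x \<otimes> \<Delta> y\<close> gives four terms, the two mixed ones contain the factor \<open>q (e \<otimes> y) = 0\<close>, and
  the others are \<open>[x, y] \<otimes> e + e \<otimes> [x, y] = \<Delta> [x, y]\<close> (\<open>lie_shelf_coalgebra_morphism\<close>).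

  In the self-distributive law the comultiplication acts on the third factor alone, and splitting
  that factor tells what the law means. For \<open>e\<close> it holds because \<open>q (u \<otimes> e) = u\<close>. For \<open>z \<in> \<gg>\<close> it
  says that \<open>D = q (- \<otimes> z)\<close> is a derivation of \<open>q\<close>, that is
  \<open>D (q (u \<otimes> v)) = q (D u \<otimes> v) + q (u \<otimes> D v)\<close>. With \<open>u = a + x\<close> and \<open>v = b + y\<close> the summands with
  factor \<open>b\<close> cancel, and what remains is the Jacobi identity in the form
  \<open>[[x, y], z] = [[x, z], y] + [x, [y, z]]\<close> (\<open>bracket_derivation\<close>).\<close>

section \<open>Linear and bilinear maps\<close>

lemma linear_maps_id: "id \<in> linear_maps R M M"
  by (rule linear_mapsI) simp_all

lemma linear_maps_comp:
  assumes "f \<in> linear_maps R A B" "g \<in> linear_maps R B C"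
  shows "g \<circ> f \<in> linear_maps R A C"
  by (rule linear_mapsI) (simp_all add: linear_mapsD[OF assms(1)] linear_mapsD[OF assms(2)])

lemma linear_maps_add:
  assumes "module R B" and f: "f \<in> linear_maps R A B" and g: "g \<in> linear_maps R A B"
  shows "(\<lambda>x. f x \<oplus>\<^bsub>B\<^esub> g x) \<in> linear_maps R A B"
proof -
  interpret B: module R B by fact
  show ?thesis
    by (rule linear_mapsI)
      (simp_all add: linear_mapsD[OF f] linear_mapsD[OF g] B.smult_r_distr B.M.a_ac)
qed

lemma linear_maps_smult:
  assumes "module R B" and f: "f \<in> linear_maps R A B" and r: "r \<in> carrier R"
  shows "(\<lambda>x. r \<odot>\<^bsub>B\<^esub> f x) \<in> linear_maps R A B"
proof -
  interpret B: module R B by fact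
  show ?thesis
    using r by (intro linear_mapsI)
      (simp_all add: linear_mapsD[OF f] B.smult_r_distr B.m_comm flip: B.smult_assoc1)
qed

lemma linear_maps_zero:
  assumes "module R A" "module R B" and f: "f \<in> linear_maps R A B"
  shows "f \<zero>\<^bsub>A\<^esub> = \<zero>\<^bsub>B\<^esub>"
proof -
  interpret A: module R A by fact
  interpret B: module R B by fact
  show ?thesis
    using linear_mapsD(3)[OF f, of "\<zero>\<^bsub>R\<^esub>" "\<zero>\<^bsub>A\<^esub>"] linear_mapsD(1)[OF f, of "\<zero>\<^bsub>A\<^esub>"] by simp
qed

lemma bilinear_map_comp:
  assumes h: "bilinear_map R C D P h"
    and f: "f \<in> linear_maps R A C" and g: "g \<in> linear_maps R B D"
  shows "bilinear_map R A B P (\<lambda>a b. h (f a) (g b))"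
proof -
  have "h (f a) \<in> linear_maps R D P" if "a \<in> carrier A" for a
    using h linear_mapsD(1)[OF f that] by (simp add: bilinear_map_def)
  moreover have "(\<lambda>c. h c (g b)) \<in> linear_maps R C P" if "b \<in> carrier B" for b
    using h linear_mapsD(1)[OF g that] by (simp add: bilinear_map_def)
  ultimately show ?thesis
    using linear_maps_comp[OF g] linear_maps_comp[OF f]
    by (fastforce simp: bilinear_map_def comp_def)
qed

lemma bilinear_map_swap:
  "bilinear_map R A B P h \<Longrightarrow> bilinear_map R B A P (\<lambda>b a. h a b)"
  by (simp add: bilinear_map_def)


lemma bilinear_smult:
  assumes "module R P"
  shows "bilinear_map R (base_module R) P P (\<lambda>r y. r \<odot>\<^bsub>P\<^esub> y)"
proof -
  interpret P: module R P by fact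
  show ?thesis
    unfolding bilinear_map_def
    by (intro conjI ballI linear_mapsI)
      (simp_all add: base_module_def P.smult_l_distr P.smult_r_distr P.m_comm flip: P.smult_assoc1)
qed


section \<open>Calculus of tensor products\<close>

lemma module_tensor:
  "module R A \<Longrightarrow> module R B \<Longrightarrow> module R (tensor_product R A B)"
  by (rule two_modules.module_tensor_product[OF two_modules.intro])

lemma tensor_add_closed:
  assumes "module R A" "module R B"
    and "s \<in> carrier (tensor_product R A B)" "t \<in> carrier (tensor_product R A B)"
  shows "s \<oplus>\<^bsub>tensor_product R A B\<^esub> t \<in> carrier (tensor_product R A B)"
proof -
  interpret module R "tensor_product R A B" by (rule module_tensor[OF assms(1,2)])
  show ?thesis using assms(3,4) by simp
qed

lemma bilinear_pure:
  "module R A \<Longrightarrow> module R B \<Longrightarrow> bilinear_map R A B (tensor_product R A B) (pure_tensor R A B)"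
  by (rule two_modules.bilinear_pure_tensor[OF two_modules.intro])

lemma pure_linear:
  assumes "module R A" "module R B"
  shows "a \<in> carrier A \<Longrightarrow> pure_tensor R A B a \<in> linear_maps R B (tensor_product R A B)"
    and "b \<in> carrier B \<Longrightarrow> (\<lambda>a. pure_tensor R A B a b) \<in> linear_maps R A (tensor_product R A B)"
  using bilinear_pure[OF assms] by (simp_all add: bilinear_map_def)

lemma pure_simps:
  assumes "module R A" "module R B"
  shows "a \<in> carrier A \<Longrightarrow> b \<in> carrier B \<Longrightarrow>
      pure_tensor R A B a b \<in> carrier (tensor_product R A B)"
    and "a \<in> carrier A \<Longrightarrow> a' \<in> carrier A \<Longrightarrow> b \<in> carrier B \<Longrightarrow>
      pure_tensor R A B (a \<oplus>\<^bsub>A\<^esub> a') b =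
        pure_tensor R A B a b \<oplus>\<^bsub>tensor_product R A B\<^esub> pure_tensor R A B a' b"
    and "a \<in> carrier A \<Longrightarrow> b \<in> carrier B \<Longrightarrow> b' \<in> carrier B \<Longrightarrow>
      pure_tensor R A B a (b \<oplus>\<^bsub>B\<^esub> b') =
        pure_tensor R A B a b \<oplus>\<^bsub>tensor_product R A B\<^esub> pure_tensor R A B a b'"
    and "b \<in> carrier B \<Longrightarrow> pure_tensor R A B \<zero>\<^bsub>A\<^esub> b = \<zero>\<^bsub>tensor_product R A B\<^esub>"
    and "a \<in> carrier A \<Longrightarrow> pure_tensor R A B a \<zero>\<^bsub>B\<^esub> = \<zero>\<^bsub>tensor_product R A B\<^esub>"
proof -
  note left = pure_linear(2)[OF assms] and right = pure_linear(1)[OF assms]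
  show "a \<in> carrier A \<Longrightarrow> b \<in> carrier B \<Longrightarrow>
      pure_tensor R A B a b \<in> carrier (tensor_product R A B)"
    by (rule linear_mapsD(1)[OF right])
  show "a \<in> carrier A \<Longrightarrow> a' \<in> carrier A \<Longrightarrow> b \<in> carrier B \<Longrightarrow>
      pure_tensor R A B (a \<oplus>\<^bsub>A\<^esub> a') b =
        pure_tensor R A B a b \<oplus>\<^bsub>tensor_product R A B\<^esub> pure_tensor R A B a' b"
    by (rule linear_mapsD(2)[OF left])
  show "a \<in> carrier A \<Longrightarrow> b \<in> carrier B \<Longrightarrow> b' \<in> carrier B \<Longrightarrow>
      pure_tensor R A B a (b \<oplus>\<^bsub>B\<^esub> b') =
        pure_tensor R A B a b \<oplus>\<^bsub>tensor_product R A B\<^esub> pure_tensor R A B a b'"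
    by (rule linear_mapsD(2)[OF right])
  show "b \<in> carrier B \<Longrightarrow> pure_tensor R A B \<zero>\<^bsub>A\<^esub> b = \<zero>\<^bsub>tensor_product R A B\<^esub>"
    by (rule linear_maps_zero[OF assms(1) module_tensor[OF assms] left])
  show "a \<in> carrier A \<Longrightarrow> pure_tensor R A B a \<zero>\<^bsub>B\<^esub> = \<zero>\<^bsub>tensor_product R A B\<^esub>"
    by (rule linear_maps_zero[OF assms(2) module_tensor[OF assms] right])
qed

lemmas tensor_eqI = two_modules.linear_maps_tensor_eqI[OF two_modules.intro]
lemmas lift_linear = two_modules.tensor_lift(1)[OF two_modules.intro]
lemmas lift_pure = two_modules.tensor_lift(2)[OF two_modules.intro]

text \<open>Uniqueness in the universal property, applied to the outer tensor product and then, with the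
  third argument fixed, to the inner one.\<close>

lemma tensor3_eqI:
  assumes m: "module R A" "module R B" "module R C" "module R P"
    and f: "f \<in> linear_maps R (tensor_product R (tensor_product R A B) C) P"
    and g: "g \<in> linear_maps R (tensor_product R (tensor_product R A B) C) P"
    and eq: "\<And>a b c. a \<in> carrier A \<Longrightarrow> b \<in> carrier B \<Longrightarrow> c \<in> carrier C \<Longrightarrow>
      f (pure_tensor R (tensor_product R A B) C (pure_tensor R A B a b) c) =
      g (pure_tensor R (tensor_product R A B) C (pure_tensor R A B a b) c)"
    and t: "t \<in> carrier (tensor_product R (tensor_product R A B) C)"
  shows "f t = g t"
proof (rule tensor_eqI[OF module_tensor[OF m(1,2)] m(3,4) f g _ t])
  fix s c assume s: "s \<in> carrier (tensor_product R A B)" and c: "c \<in> carrier C"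
  note lin = linear_maps_comp[OF pure_linear(2)[OF module_tensor[OF m(1,2)] m(3) c], unfolded comp_def]
  show "f (pure_tensor R (tensor_product R A B) C s c) = g (pure_tensor R (tensor_product R A B) C s c)"
    by (rule tensor_eqI[OF m(1,2,4) lin[OF f] lin[OF g] eq[OF _ _ c] s])
qed

text \<open>The associativity maps are lifts of lifts, and this makes the outer lift legitimate: a
  trilinear map induces a bilinear one on \<open>(A \<otimes> B) \<times> C\<close>. Linearity in \<open>c\<close> is not visible
  from the inner lift; it follows from uniqueness, because both sides of each law are linear in
  the tensor and agree on pure tensors.\<close>

lemma bilinear_lift_family:
  assumes m: "module R A" "module R B" "module R C" "module R P"
    and ab: "\<And>c. c \<in> carrier C \<Longrightarrow> bilinear_map R A B P (\<lambda>a b. h a b c)"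
    and c: "\<And>a b. a \<in> carrier A \<Longrightarrow> b \<in> carrier B \<Longrightarrow> h a b \<in> linear_maps R C P"
  shows "bilinear_map R (tensor_product R A B) C P (\<lambda>s c. tensor_lift R A B P (\<lambda>a b. h a b c) s)"
proof -
  interpret C: module R C by fact
  let ?l = "\<lambda>s c. tensor_lift R A B P (\<lambda>a b. h a b c) s"
  have lin: "(\<lambda>s. ?l s c) \<in> linear_maps R (tensor_product R A B) P" if "c \<in> carrier C" for c
    by (rule lift_linear[OF m(1,2,4) ab[OF that]])
  have pure: "?l (pure_tensor R A B a b) c = h a b c"
    if "c \<in> carrier C" "a \<in> carrier A" "b \<in> carrier B" for a b c
    by (rule lift_pure[OF m(1,2,4) ab[OF that(1)] that(2,3)])
  have "?l s \<in> linear_maps R C P" if s: "s \<in> carrier (tensor_product R A B)" for s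
  proof (rule linear_mapsI)
    show "?l s c \<in> carrier P" if "c \<in> carrier C" for c
      by (rule linear_mapsD(1)[OF lin[OF that] s])
    show "?l s (c \<oplus>\<^bsub>C\<^esub> d) = ?l s c \<oplus>\<^bsub>P\<^esub> ?l s d" if "c \<in> carrier C" "d \<in> carrier C" for c d
      by (rule tensor_eqI[OF m(1,2,4) lin linear_maps_add[OF m(4) lin lin] _ s])
        (use that in \<open>simp_all add: pure linear_mapsD(2)[OF c]\<close>)
    show "?l s (r \<odot>\<^bsub>C\<^esub> c) = r \<odot>\<^bsub>P\<^esub> ?l s c" if "r \<in> carrier R" "c \<in> carrier C" for r c
      by (rule tensor_eqI[OF m(1,2,4) lin linear_maps_smult[OF m(4) lin] _ s])
        (use that in \<open>simp_all add: pure linear_mapsD(3)[OF c]\<close>)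
  qed
  with lin show ?thesis by (simp add: bilinear_map_def)
qed

lemma tensor_map_linear_pure:
  assumes m: "module R A" "module R B" "module R C" "module R D"
    and fg: "f \<in> linear_maps R A C" "g \<in> linear_maps R B D"
  shows tensor_map_linear:
      "tensor_map R A B C D f g \<in> linear_maps R (tensor_product R A B) (tensor_product R C D)"
    and tensor_map_pure: "a \<in> carrier A \<Longrightarrow> b \<in> carrier B \<Longrightarrow>
      tensor_map R A B C D f g (pure_tensor R A B a b) = pure_tensor R C D (f a) (g b)"
proof -
  note bil = bilinear_map_comp[OF bilinear_pure[OF m(3,4)] fg]
  show "tensor_map R A B C D f g \<in> linear_maps R (tensor_product R A B) (tensor_product R C D)"
    unfolding tensor_map_def by (rule lift_linear[OF m(1,2) module_tensor[OF m(3,4)] bil])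
  show "a \<in> carrier A \<Longrightarrow> b \<in> carrier B \<Longrightarrow>
      tensor_map R A B C D f g (pure_tensor R A B a b) = pure_tensor R C D (f a) (g b)"
    unfolding tensor_map_def by (rule lift_pure[OF m(1,2) module_tensor[OF m(3,4)] bil])
qed

lemma tensor_flip_linear_pure:
  assumes m: "module R A" "module R B"
  shows tensor_flip_linear:
      "tensor_flip R A B \<in> linear_maps R (tensor_product R A B) (tensor_product R B A)"
    and tensor_flip_pure: "a \<in> carrier A \<Longrightarrow> b \<in> carrier B \<Longrightarrow>
      tensor_flip R A B (pure_tensor R A B a b) = pure_tensor R B A b a"
proof -
  note bil = bilinear_map_swap[OF bilinear_pure[OF m(2,1)]]
  show "tensor_flip R A B \<in> linear_maps R (tensor_product R A B) (tensor_product R B A)"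
    unfolding tensor_flip_def by (rule lift_linear[OF m module_tensor[OF m(2,1)] bil])
  show "a \<in> carrier A \<Longrightarrow> b \<in> carrier B \<Longrightarrow>
      tensor_flip R A B (pure_tensor R A B a b) = pure_tensor R B A b a"
    unfolding tensor_flip_def by (rule lift_pure[OF m module_tensor[OF m(2,1)] bil])
qed

lemma tensor_assoc_linear_pure:
  assumes m: "module R A" "module R B" "module R C"
  shows tensor_assoc_linear: "tensor_assoc R A B C \<in> linear_maps R
      (tensor_product R (tensor_product R A B) C) (tensor_product R A (tensor_product R B C))"
    and tensor_assoc_pure: "a \<in> carrier A \<Longrightarrow> b \<in> carrier B \<Longrightarrow> c \<in> carrier C \<Longrightarrow>
      tensor_assoc R A B C (pure_tensor R (tensor_product R A B) C (pure_tensor R A B a b) c) =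
      pure_tensor R A (tensor_product R B C) a (pure_tensor R B C b c)"
proof -
  let ?BC = "tensor_product R B C"
  let ?T = "tensor_product R A ?BC"
  let ?h = "\<lambda>a b c. pure_tensor R A ?BC a (pure_tensor R B C b c)"
  note mBC = module_tensor[OF m(2,3)] and mAB = module_tensor[OF m(1,2)]
  note mT = module_tensor[OF m(1) mBC]
  have ab: "bilinear_map R A B ?T (\<lambda>a b. ?h a b c)" if "c \<in> carrier C" for c
    using bilinear_map_comp[OF bilinear_pure[OF m(1) mBC] linear_maps_id
        pure_linear(2)[OF m(2,3) that]] by simp
  have "?h a b \<in> linear_maps R C ?T" if "a \<in> carrier A" "b \<in> carrier B" for a b
    using linear_maps_comp[OF pure_linear(1)[OF m(2,3) that(2)] pure_linear(1)[OF m(1) mBC that(1)]]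
    by (simp add: comp_def)
  note bil = bilinear_lift_family[OF m mT ab this]
  show "tensor_assoc R A B C \<in> linear_maps R (tensor_product R (tensor_product R A B) C) ?T"
    unfolding tensor_assoc_def Let_def by (rule lift_linear[OF mAB m(3) mT bil])
  show "tensor_assoc R A B C (pure_tensor R (tensor_product R A B) C (pure_tensor R A B a b) c) =
      ?h a b c" if "a \<in> carrier A" "b \<in> carrier B" "c \<in> carrier C"
    using that by (simp add: tensor_assoc_def Let_def lift_pure[OF mAB m(3) mT bil]
        lift_pure[OF m(1,2) mT ab] pure_simps m)
qed

lemma tensor_assoc_inv_linear_pure:
  assumes m: "module R A" "module R B" "module R C"
  shows tensor_assoc_inv_linear: "tensor_assoc_inv R A B C \<in> linear_maps R
      (tensor_product R A (tensor_product R B C)) (tensor_product R (tensor_product R A B) C)"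
    and tensor_assoc_inv_pure: "a \<in> carrier A \<Longrightarrow> b \<in> carrier B \<Longrightarrow> c \<in> carrier C \<Longrightarrow>
      tensor_assoc_inv R A B C (pure_tensor R A (tensor_product R B C) a (pure_tensor R B C b c)) =
      pure_tensor R (tensor_product R A B) C (pure_tensor R A B a b) c"
proof -
  let ?AB = "tensor_product R A B"
  let ?T = "tensor_product R ?AB C"
  let ?h = "\<lambda>b c a. pure_tensor R ?AB C (pure_tensor R A B a b) c"
  note mBC = module_tensor[OF m(2,3)] and mAB = module_tensor[OF m(1,2)]
  note mT = module_tensor[OF mAB m(3)]
  have bc: "bilinear_map R B C ?T (\<lambda>b c. ?h b c a)" if "a \<in> carrier A" for a
    using bilinear_map_comp[OF bilinear_pure[OF mAB m(3)] pure_linear(1)[OF m(1,2) that]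
        linear_maps_id] by simp
  have "?h b c \<in> linear_maps R A ?T" if "b \<in> carrier B" "c \<in> carrier C" for b c
    using linear_maps_comp[OF pure_linear(2)[OF m(1,2) that(1)] pure_linear(2)[OF mAB m(3) that(2)]]
    by (simp add: comp_def)
  note bil = bilinear_map_swap[OF bilinear_lift_family[OF m(2,3,1) mT bc this]]
  show "tensor_assoc_inv R A B C \<in> linear_maps R (tensor_product R A (tensor_product R B C)) ?T"
    unfolding tensor_assoc_inv_def Let_def by (rule lift_linear[OF m(1) mBC mT bil])
  show "tensor_assoc_inv R A B C (pure_tensor R A (tensor_product R B C) a (pure_tensor R B C b c)) =
      ?h b c a" if "a \<in> carrier A" "b \<in> carrier B" "c \<in> carrier C"
    using that by (simp add: tensor_assoc_inv_def Let_def lift_pure[OF m(1) mBC mT bil]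
        lift_pure[OF m(2,3) mT bc] pure_simps m)
qed

text \<open>Linearity together with the value on pure tensors of pure tensors replaces the chain of
  associativity isomorphisms in all later computations.\<close>

lemma tensor_mid_flip_linear_pure:
  assumes m: "module R A" "module R B" "module R C" "module R D"
  shows tensor_mid_flip_linear: "tensor_mid_flip R A B C D \<in> linear_maps R
      (tensor_product R (tensor_product R A B) (tensor_product R C D))
      (tensor_product R (tensor_product R A C) (tensor_product R B D))"
    and tensor_mid_flip_pure:
      "a \<in> carrier A \<Longrightarrow> b \<in> carrier B \<Longrightarrow> c \<in> carrier C \<Longrightarrow> d \<in> carrier D \<Longrightarrow>
      tensor_mid_flip R A B C D (pure_tensor R (tensor_product R A B) (tensor_product R C D)
        (pure_tensor R A B a b) (pure_tensor R C D c d)) =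
      pure_tensor R (tensor_product R A C) (tensor_product R B D)
        (pure_tensor R A C a c) (pure_tensor R B D b d)"
proof -
  note intros = linear_maps_comp linear_maps_id tensor_map_linear tensor_flip_linear
    tensor_assoc_linear tensor_assoc_inv_linear module_tensor m
  show "tensor_mid_flip R A B C D \<in> linear_maps R
      (tensor_product R (tensor_product R A B) (tensor_product R C D))
      (tensor_product R (tensor_product R A C) (tensor_product R B D))"
    unfolding tensor_mid_flip_def by (rule intros)+
  have inner: "tensor_assoc R C B D \<circ>
      tensor_map R (tensor_product R B C) D (tensor_product R C B) D (tensor_flip R B C) id \<circ>
      tensor_assoc_inv R B C D \<in> linear_maps R (tensor_product R B (tensor_product R C D))
        (tensor_product R C (tensor_product R B D))"
    by (rule intros)+
  show "tensor_mid_flip R A B C D (pure_tensor R (tensor_product R A B) (tensor_product R C D)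
        (pure_tensor R A B a b) (pure_tensor R C D c d)) =
      pure_tensor R (tensor_product R A C) (tensor_product R B D)
        (pure_tensor R A C a c) (pure_tensor R B D b d)"
    if "a \<in> carrier A" "b \<in> carrier B" "c \<in> carrier C" "d \<in> carrier D"
    using that
    by (simp add: tensor_mid_flip_def tensor_map_pure inner tensor_assoc_pure tensor_assoc_inv_pure
        tensor_flip_pure tensor_flip_linear linear_maps_id module_tensor pure_simps m)
qed

lemmas tensor_linear = linear_maps_id tensor_map_linear tensor_flip_linear tensor_assoc_linear
  tensor_mid_flip_linear

text \<open>The simplification rules that evaluate a composite of structural maps on a sum of pure tensors.
  The side conditions are discharged by the module, closure and linearity facts in the same list.\<close>

lemmas tensor_eval = pure_simps tensor_add_closed module_tensor tensor_linear
  tensor_map_pure tensor_flip_pure tensor_assoc_pure tensor_mid_flip_pure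
  linear_mapsD(1,2)[OF tensor_map_linear] linear_mapsD(1,2)[OF tensor_flip_linear]
  linear_mapsD(1,2)[OF tensor_assoc_linear] linear_mapsD(1,2)[OF tensor_mid_flip_linear]


section \<open>The coalgebra of a Lie algebra\<close>

context lie_algebra
begin

abbreviation (input) "N \<equiv> lie_coalg K L"
abbreviation (input) "NN \<equiv> tensor_product K N N"
abbreviation (input) "e \<equiv> (\<one>\<^bsub>K\<^esub>, \<zero>\<^bsub>L\<^esub>)"
abbreviation (input) "k \<equiv> base_module K"
abbreviation (input) "q \<equiv> lie_shelf_op K L bracket"
abbreviation (input) "\<Delta> \<equiv> lie_comult K L"

lemma lie_coalg_simps:
  "(a, x) \<in> carrier N \<longleftrightarrow> a \<in> carrier K \<and> x \<in> carrier L"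
  "(a, x) \<oplus>\<^bsub>N\<^esub> (b, y) = (a \<oplus>\<^bsub>K\<^esub> b, x \<oplus>\<^bsub>L\<^esub> y)"
  "r \<odot>\<^bsub>N\<^esub> (a, x) = (r \<otimes>\<^bsub>K\<^esub> a, r \<odot>\<^bsub>L\<^esub> x)"
  "\<zero>\<^bsub>N\<^esub> = (\<zero>\<^bsub>K\<^esub>, \<zero>\<^bsub>L\<^esub>)"
  by (simp_all add: lie_coalg_def direct_sum_def base_module_def)

lemma base_simps:
  "carrier k = carrier K" "a \<oplus>\<^bsub>k\<^esub> b = a \<oplus>\<^bsub>K\<^esub> b" "a \<odot>\<^bsub>k\<^esub> b = a \<otimes>\<^bsub>K\<^esub> b"
  by (simp_all add: base_module_def)

lemma bracket_zero:
  assumes "x \<in> carrier L"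
  shows "bracket x \<zero>\<^bsub>L\<^esub> = \<zero>\<^bsub>L\<^esub>" "bracket \<zero>\<^bsub>L\<^esub> x = \<zero>\<^bsub>L\<^esub>"
  using bracket_bilinear assms
    linear_maps_zero[OF module_axioms module_axioms, of "bracket x"]
    linear_maps_zero[OF module_axioms module_axioms, of "\<lambda>y. bracket y x"]
  by (simp_all add: bilinear_map_def)

text \<open>The unit \<open>e\<close> and \<open>\<gg>\<close> generate \<open>N\<close>, as \<open>(a, x) = a e + (0, x)\<close>.\<close>

lemma lie_coalg_linear_eqI:
  assumes P: "module K P" and f: "f \<in> linear_maps K N P" and g: "g \<in> linear_maps K N P"
    and e: "f e = g e" and x: "\<And>x. x \<in> carrier L \<Longrightarrow> f (\<zero>\<^bsub>K\<^esub>, x) = g (\<zero>\<^bsub>K\<^esub>, x)"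
    and u: "u \<in> carrier N"
  shows "f u = g u"
proof -
  obtain a x where ax: "u = (a, x)" "a \<in> carrier K" "x \<in> carrier L"
    using u by (cases u) (simp add: lie_coalg_simps)
  then have u_eq: "u = a \<odot>\<^bsub>N\<^esub> e \<oplus>\<^bsub>N\<^esub> (\<zero>\<^bsub>K\<^esub>, x)"
    by (simp add: lie_coalg_simps)
  have mem: "e \<in> carrier N" "a \<odot>\<^bsub>N\<^esub> e \<in> carrier N" "(\<zero>\<^bsub>K\<^esub>, x) \<in> carrier N"
    using ax by (simp_all add: lie_coalg_simps)
  show ?thesis
    unfolding u_eq using ax mem
    by (simp only: linear_mapsD[OF f] linear_mapsD[OF g] e x)
qed

lemma lie_tensor_linear_eqI:
  assumes P: "module K P" and f: "f \<in> linear_maps K NN P" and g: "g \<in> linear_maps K NN P"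
    and "f (pure_tensor K N N e e) = g (pure_tensor K N N e e)"
    and "\<And>x. x \<in> carrier L \<Longrightarrow>
      f (pure_tensor K N N (\<zero>\<^bsub>K\<^esub>, x) e) = g (pure_tensor K N N (\<zero>\<^bsub>K\<^esub>, x) e)"
    and "\<And>y. y \<in> carrier L \<Longrightarrow>
      f (pure_tensor K N N e (\<zero>\<^bsub>K\<^esub>, y)) = g (pure_tensor K N N e (\<zero>\<^bsub>K\<^esub>, y))"
    and "\<And>x y. x \<in> carrier L \<Longrightarrow> y \<in> carrier L \<Longrightarrow>
      f (pure_tensor K N N (\<zero>\<^bsub>K\<^esub>, x) (\<zero>\<^bsub>K\<^esub>, y)) = g (pure_tensor K N N (\<zero>\<^bsub>K\<^esub>, x) (\<zero>\<^bsub>K\<^esub>, y))"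
    and t: "t \<in> carrier NN"
  shows "f t = g t"
proof (rule tensor_eqI[OF module_lie_coalg module_lie_coalg P f g _ t])
  note lin1 = linear_maps_comp[OF pure_linear(1)[OF module_lie_coalg module_lie_coalg], unfolded comp_def]
  note lin2 = linear_maps_comp[OF pure_linear(2)[OF module_lie_coalg module_lie_coalg], unfolded comp_def]
  fix u v assume u: "u \<in> carrier N" and v: "v \<in> carrier N"
  have e: "f (pure_tensor K N N u e) = g (pure_tensor K N N u e)"
    by (rule lie_coalg_linear_eqI[OF P lin2[OF _ f] lin2[OF _ g] _ _ u])
      (simp_all add: assms lie_coalg_simps)
  have y: "f (pure_tensor K N N u (\<zero>\<^bsub>K\<^esub>, y)) = g (pure_tensor K N N u (\<zero>\<^bsub>K\<^esub>, y))"
    if "y \<in> carrier L" for y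
    by (rule lie_coalg_linear_eqI[OF P lin2[OF _ f] lin2[OF _ g] _ _ u])
      (simp_all add: assms lie_coalg_simps that)
  show "f (pure_tensor K N N u v) = g (pure_tensor K N N u v)"
    by (rule lie_coalg_linear_eqI[OF P lin1[OF u f] lin1[OF u g] e y v])
qed

text \<open>The zero of \<open>N\<close> appears as a pair in computations, a form to which the general
  rules for \<open>\<zero>\<^bsub>N\<^esub>\<close> do not apply syntactically.\<close>

lemma lie_pure_zero:
  assumes "module K P" "u \<in> carrier P"
  shows "pure_tensor K N P (\<zero>\<^bsub>K\<^esub>, \<zero>\<^bsub>L\<^esub>) u = \<zero>\<^bsub>tensor_product K N P\<^esub>"
    and "pure_tensor K P N u (\<zero>\<^bsub>K\<^esub>, \<zero>\<^bsub>L\<^esub>) = \<zero>\<^bsub>tensor_product K P N\<^esub>"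
  using pure_simps(4)[OF module_lie_coalg assms] pure_simps(5)[OF assms(1) module_lie_coalg assms(2)]
  by (simp_all add: lie_coalg_simps)

lemma lie_comult_linear: "\<Delta> \<in> linear_maps K N NN"
proof -
  interpret NN: module K NN by (intro module_tensor module_lie_coalg)
  have r: "(\<lambda>x. pure_tensor K N N u (\<zero>\<^bsub>K\<^esub>, x)) \<in> linear_maps K L NN"
    and l: "(\<lambda>x. pure_tensor K N N (\<zero>\<^bsub>K\<^esub>, x) u) \<in> linear_maps K L NN" if "u \<in> carrier N" for u
  proof -
    have i: "Pair \<zero>\<^bsub>K\<^esub> \<in> linear_maps K L N"
      by (rule linear_mapsI) (simp_all add: lie_coalg_simps)
    show "(\<lambda>x. pure_tensor K N N u (\<zero>\<^bsub>K\<^esub>, x)) \<in> linear_maps K L NN"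
      using linear_maps_comp[OF i pure_linear(1)[OF module_lie_coalg module_lie_coalg that]]
      by (simp add: comp_def)
    show "(\<lambda>x. pure_tensor K N N (\<zero>\<^bsub>K\<^esub>, x) u) \<in> linear_maps K L NN"
      using linear_maps_comp[OF i pure_linear(2)[OF module_lie_coalg module_lie_coalg that]]
      by (simp add: comp_def)
  qed
  have e: "e \<in> carrier N" by (simp add: lie_coalg_simps)
  have ee: "pure_tensor K N N e e \<in> carrier NN"
    by (rule pure_simps(1)[OF module_lie_coalg module_lie_coalg e e])
  \<comment> \<open>The primitive part \<open>x \<mapsto> x \<otimes> e + e \<otimes> x\<close> of \<open>\<Delta>\<close> is linear on \<open>\<gg>\<close>.\<close>
  note p = linear_maps_add[OF NN.module_axioms l[OF e] r[OF e]]
  show ?thesis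
  proof (rule linear_mapsI)
    fix u v assume "u \<in> carrier N" "v \<in> carrier N"
    then show "\<Delta> (u \<oplus>\<^bsub>N\<^esub> v) = \<Delta> u \<oplus>\<^bsub>NN\<^esub> \<Delta> v"
      using ee linear_mapsD[OF p]
      by (cases u; cases v) (simp add: lie_comult_def Let_def lie_coalg_simps NN.smult_l_distr NN.M.a_ac)
  next
    fix r u assume "r \<in> carrier K" "u \<in> carrier N"
    then show "\<Delta> (r \<odot>\<^bsub>N\<^esub> u) = r \<odot>\<^bsub>NN\<^esub> \<Delta> u"
      using ee linear_mapsD[OF p]
      by (cases u) (simp add: lie_comult_def Let_def lie_coalg_simps NN.smult_assoc1 NN.smult_r_distr)
  next
    fix u assume "u \<in> carrier N"
    then show "\<Delta> u \<in> carrier NN"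
      using ee linear_mapsD(1)[OF p]
      by (cases u) (simp add: lie_comult_def Let_def lie_coalg_simps)
  qed
qed

lemma lie_comult_gen:
  "\<Delta> e = pure_tensor K N N e e"
  "x \<in> carrier L \<Longrightarrow> \<Delta> (\<zero>\<^bsub>K\<^esub>, x) =
    pure_tensor K N N (\<zero>\<^bsub>K\<^esub>, x) e \<oplus>\<^bsub>NN\<^esub> pure_tensor K N N e (\<zero>\<^bsub>K\<^esub>, x)"
proof -
  interpret NN: module K NN by (intro module_tensor module_lie_coalg)
  show "\<Delta> e = pure_tensor K N N e e"
    and "x \<in> carrier L \<Longrightarrow> \<Delta> (\<zero>\<^bsub>K\<^esub>, x) =
      pure_tensor K N N (\<zero>\<^bsub>K\<^esub>, x) e \<oplus>\<^bsub>NN\<^esub> pure_tensor K N N e (\<zero>\<^bsub>K\<^esub>, x)"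
    by (simp_all add: lie_comult_def Let_def pure_simps(1)[OF module_lie_coalg module_lie_coalg]
        lie_pure_zero[OF module_lie_coalg] lie_coalg_simps)
qed

lemma lie_counit_linear: "lie_counit \<in> linear_maps K N k"
  by (rule linear_mapsI) (auto simp: lie_counit_def lie_coalg_simps base_simps split: prod.splits)

lemma lie_counit_simp: "lie_counit (a, x) = a"
  by (simp add: lie_counit_def)

lemmas lie_eval = tensor_eval module_lie_coalg K.module_base_module lie_comult_linear
  lie_counit_linear lie_counit_simp lie_comult_gen lie_coalg_simps base_simps

lemma lie_coassociative:
  assumes "u \<in> carrier N"
  shows "tensor_assoc K N N N (tensor_map K N N NN N \<Delta> id (\<Delta> u)) =
    tensor_map K N N N NN id \<Delta> (\<Delta> u)"
proof -
  interpret NNN: module K "tensor_product K N NN" by (intro module_tensor module_lie_coalg)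
  let ?l = "tensor_assoc K N N N \<circ> (tensor_map K N N NN N \<Delta> id \<circ> \<Delta>)"
  let ?r = "tensor_map K N N N NN id \<Delta> \<circ> \<Delta>"
  have l: "?l \<in> linear_maps K N (tensor_product K N NN)"
    by (rule linear_maps_comp tensor_linear module_tensor module_lie_coalg lie_comult_linear)+
  have r: "?r \<in> linear_maps K N (tensor_product K N NN)"
    by (rule linear_maps_comp tensor_linear module_tensor module_lie_coalg lie_comult_linear)+
  have "?l u = ?r u"
  proof (rule lie_coalg_linear_eqI[OF NNN.module_axioms l r _ _ assms])
    show "?l e = ?r e"
      by (simp add: lie_eval)
    show "?l (\<zero>\<^bsub>K\<^esub>, x) = ?r (\<zero>\<^bsub>K\<^esub>, x)" if "x \<in> carrier L" for x
      using that by (simp add: lie_eval NNN.M.a_assoc)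
  qed
  then show ?thesis by simp
qed

lemma lie_cocommutative:
  assumes "u \<in> carrier N"
  shows "tensor_flip K N N (\<Delta> u) = \<Delta> u"
proof -
  interpret NN: module K NN by (intro module_tensor module_lie_coalg)
  have l: "tensor_flip K N N \<circ> \<Delta> \<in> linear_maps K N NN"
    by (rule linear_maps_comp tensor_linear module_lie_coalg lie_comult_linear)+
  have "(tensor_flip K N N \<circ> \<Delta>) u = \<Delta> u"
  proof (rule lie_coalg_linear_eqI[OF NN.module_axioms l lie_comult_linear _ _ assms])
    show "(tensor_flip K N N \<circ> \<Delta>) e = \<Delta> e"
      by (simp add: lie_eval)
    show "(tensor_flip K N N \<circ> \<Delta>) (\<zero>\<^bsub>K\<^esub>, x) = \<Delta> (\<zero>\<^bsub>K\<^esub>, x)" if "x \<in> carrier L" for x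
      using that by (simp add: lie_eval NN.M.a_comm)
  qed
  then show ?thesis by simp
qed

lemma lie_counit_left:
  assumes "u \<in> carrier N"
  shows "tensor_lift K k N N (\<lambda>r y. r \<odot>\<^bsub>N\<^esub> y) (tensor_map K N N k N lie_counit id (\<Delta> u)) = u"
proof -
  note bil = bilinear_smult[OF module_lie_coalg]
  note lin = lift_linear[OF K.module_base_module module_lie_coalg module_lie_coalg bil]
  note pure = lift_pure[OF K.module_base_module module_lie_coalg module_lie_coalg bil]
  let ?l = "tensor_lift K k N N (\<lambda>r y. r \<odot>\<^bsub>N\<^esub> y) \<circ> (tensor_map K N N k N lie_counit id \<circ> \<Delta>)"
  have l: "?l \<in> linear_maps K N N"
    by (rule linear_maps_comp tensor_linear lin lie_comult_linear lie_counit_linear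
        module_lie_coalg K.module_base_module)+
  have "?l u = id u"
  proof (rule lie_coalg_linear_eqI[OF module_lie_coalg l linear_maps_id _ _ assms])
    show "?l e = id e"
      by (simp add: lie_eval pure)
    show "?l (\<zero>\<^bsub>K\<^esub>, x) = id (\<zero>\<^bsub>K\<^esub>, x)" if "x \<in> carrier L" for x
      using that by (simp add: lie_eval linear_mapsD(2)[OF lin] pure)
  qed
  then show ?thesis by simp
qed

lemma lie_counit_right:
  assumes "u \<in> carrier N"
  shows "tensor_lift K N k N (\<lambda>y r. r \<odot>\<^bsub>N\<^esub> y) (tensor_map K N N N k id lie_counit (\<Delta> u)) = u"
proof -
  note bil = bilinear_map_swap[OF bilinear_smult[OF module_lie_coalg]]
  note lin = lift_linear[OF module_lie_coalg K.module_base_module module_lie_coalg bil]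
  note pure = lift_pure[OF module_lie_coalg K.module_base_module module_lie_coalg bil]
  let ?l = "tensor_lift K N k N (\<lambda>y r. r \<odot>\<^bsub>N\<^esub> y) \<circ> (tensor_map K N N N k id lie_counit \<circ> \<Delta>)"
  have l: "?l \<in> linear_maps K N N"
    by (rule linear_maps_comp tensor_linear lin lie_comult_linear lie_counit_linear
        module_lie_coalg K.module_base_module)+
  have "?l u = id u"
  proof (rule lie_coalg_linear_eqI[OF module_lie_coalg l linear_maps_id _ _ assms])
    show "?l e = id e"
      by (simp add: lie_eval pure)
    show "?l (\<zero>\<^bsub>K\<^esub>, x) = id (\<zero>\<^bsub>K\<^esub>, x)" if "x \<in> carrier L" for x
      using that by (simp add: lie_eval linear_mapsD(2)[OF lin] pure)
  qed
  then show ?thesis by simp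
qed

theorem lie_cocommutative_coalgebra: "cocommutative_coalgebra K N \<Delta> lie_counit"
  by (intro cocommutative_coalgebra.intro coalgebra.intro coalgebra_axioms.intro
      cocommutative_coalgebra_axioms.intro module_lie_coalg lie_comult_linear lie_counit_linear
      lie_coassociative lie_counit_left lie_counit_right lie_cocommutative)


section \<open>The shelf operation\<close>

lemmas lie_shelf_eval = lie_eval lie_shelf_op linear_mapsD(1,2)[OF lie_shelf_op(1)]
  bracket_zero bracket_simps lie_pure_zero

text \<open>On \<open>x \<otimes> y\<close>, the identity \<open>q (e \<otimes> y) = 0\<close> removes the terms
  \<open>q (x \<otimes> e) \<otimes> q (e \<otimes> y)\<close> and \<open>q (e \<otimes> y) \<otimes> q (x \<otimes> e)\<close> that have no counterpart in \<open>\<Delta> [x, y]\<close>.\<close>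

lemma lie_shelf_coalgebra_morphism: "coalgebra_morphism_op K N \<Delta> lie_counit q"
proof -
  interpret NN: module K NN by (intro module_tensor module_lie_coalg)
  note m = module_tensor module_lie_coalg lie_comult_linear lie_counit_linear lie_shelf_op(1)
    K.module_base_module
  note bil = bilinear_smult[OF K.module_base_module, unfolded base_simps]
  note lin = lift_linear[OF K.module_base_module K.module_base_module K.module_base_module bil]
  note pure = lift_pure[OF K.module_base_module K.module_base_module K.module_base_module bil]
  let ?l = "\<Delta> \<circ> q"
  let ?r = "tensor_map K NN NN N N q q \<circ> tensor_mid_flip K N N N N \<circ>
    tensor_map K N N NN NN \<Delta> \<Delta>"
  have l: "?l \<in> linear_maps K NN NN"
    by (rule linear_maps_comp m)+
  have r: "?r \<in> linear_maps K NN NN"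
    by (rule linear_maps_comp tensor_linear m)+
  have "?l t = ?r t" if "t \<in> carrier NN" for t
    by (rule lie_tensor_linear_eqI[OF NN.module_axioms l r _ _ _ _ that])
      (simp_all add: lie_shelf_eval)
  moreover
  let ?l = "lie_counit \<circ> q"
  let ?r = "tensor_lift K k k k (\<lambda>r s. r \<otimes>\<^bsub>K\<^esub> s) \<circ> tensor_map K N N k k lie_counit lie_counit"
  have l: "?l \<in> linear_maps K NN k"
    by (rule linear_maps_comp m)+
  have r: "?r \<in> linear_maps K NN k"
    by (rule linear_maps_comp tensor_linear lin m)+
  have "?l t = ?r t" if "t \<in> carrier NN" for t
    by (rule lie_tensor_linear_eqI[OF K.module_base_module l r _ _ _ _ that])
      (simp_all add: lie_shelf_eval pure)
  ultimately show ?thesis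
    using lie_shelf_op(1) by (simp add: coalgebra_morphism_op_def Let_def)
qed

lemma bracket_antisym:
  assumes "x \<in> carrier L" "y \<in> carrier L"
  shows "bracket y x = \<ominus>\<^bsub>L\<^esub> bracket x y"
proof -
  \<comment> \<open>Polarisation of \<open>[x, x] = 0\<close>.\<close>
  have "bracket (x \<oplus>\<^bsub>L\<^esub> y) (x \<oplus>\<^bsub>L\<^esub> y) = bracket y x \<oplus>\<^bsub>L\<^esub> bracket x y"
    using assms by (simp add: bracket_simps bracket_self[of x] bracket_self[of y] M.a_comm)
  then show ?thesis
    using assms bracket_self[of "x \<oplus>\<^bsub>L\<^esub> y"] by (simp add: M.minus_equality bracket_simps)
qed

text \<open>Bracketing with \<open>z\<close> from the right is a derivation of the bracket: the Jacobi
  identity, rearranged by antisymmetry.\<close>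

lemma bracket_derivation:
  assumes xyz: "x \<in> carrier L" "y \<in> carrier L" "z \<in> carrier L"
  shows "bracket (bracket x y) z = bracket (bracket x z) y \<oplus>\<^bsub>L\<^esub> bracket x (bracket y z)"
proof -
  note cl = xyz bracket_simps(1)
  have "bracket (bracket x y) z = \<ominus>\<^bsub>L\<^esub> bracket z (bracket x y)"
    using cl by (intro bracket_antisym) simp_all
  also have "\<dots> = bracket x (bracket y z) \<oplus>\<^bsub>L\<^esub> bracket y (bracket z x)"
    using cl jacobi[OF xyz] by (intro M.minus_equality) simp_all
  also have "bracket y (bracket z x) = \<ominus>\<^bsub>L\<^esub> bracket (bracket z x) y"
    using cl by (intro bracket_antisym) simp_all
  also have "\<dots> = bracket (bracket x z) y"
  proof (rule M.minus_equality)
    have "bracket x z \<oplus>\<^bsub>L\<^esub> bracket z x = \<zero>\<^bsub>L\<^esub>"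
      using cl by (simp add: bracket_antisym[of x z] M.r_neg)
    then show "bracket (bracket x z) y \<oplus>\<^bsub>L\<^esub> bracket (bracket z x) y = \<zero>\<^bsub>L\<^esub>"
      using cl by (simp add: bracket_zero flip: bracket_simps(2))
  qed (use cl in simp_all)
  finally show ?thesis using cl by (simp add: M.a_comm)
qed

text \<open>Only the third argument, to which \<open>\<Delta>\<close> is applied, is split into generators; the other two are
  general pairs, for which \<open>q\<close> can be evaluated directly.\<close>

lemma lie_shelf_self_distributive: "self_distributive K N \<Delta> q"
proof -
  let ?l = "q \<circ> tensor_map K NN N N N q id"
  let ?r = "q \<circ> tensor_map K NN NN N N q q \<circ> tensor_mid_flip K N N N N \<circ>
    tensor_map K NN N NN NN (tensor_map K N N N N id id) \<Delta>"
  note m = module_tensor module_lie_coalg lie_comult_linear lie_shelf_op(1)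
  have l: "?l \<in> linear_maps K (tensor_product K NN N) N"
    by (rule linear_maps_comp tensor_linear m)+
  have r: "?r \<in> linear_maps K (tensor_product K NN N) N"
    by (rule linear_maps_comp tensor_linear m)+
  have "?l t = ?r t" if "t \<in> carrier (tensor_product K NN N)" for t
  proof (rule tensor3_eqI[OF module_lie_coalg module_lie_coalg module_lie_coalg module_lie_coalg
        l r _ that])
    fix u v w assume uvw: "u \<in> carrier N" "v \<in> carrier N" "w \<in> carrier N"
    obtain a x b y where uv: "u = (a, x)" "a \<in> carrier K" "x \<in> carrier L"
        "v = (b, y)" "b \<in> carrier K" "y \<in> carrier L"
      using uvw by (cases u; cases v) (simp add: lie_coalg_simps)
    define s where "s = pure_tensor K N N u v"
    have s: "s \<in> carrier NN"
      using uvw by (simp add: s_def lie_eval)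
    note lin = linear_maps_comp[OF pure_linear(1)[OF module_tensor[OF module_lie_coalg
            module_lie_coalg] module_lie_coalg s]]
    have "(?l \<circ> pure_tensor K NN N s) w = (?r \<circ> pure_tensor K NN N s) w"
    proof (rule lie_coalg_linear_eqI[OF module_lie_coalg lin[OF l] lin[OF r] _ _ uvw(3)])
      show "(?l \<circ> pure_tensor K NN N s) e = (?r \<circ> pure_tensor K NN N s) e"
        using uv by (simp add: s_def lie_shelf_eval)
      \<comment> \<open>The second components are
        \<open>b [x, z] + [[x, y], z]\<close> and \<open>b [x, z] + [[x, z], y] + [x, [y, z]]\<close>.\<close>
      fix z assume "z \<in> carrier L"
      then show "(?l \<circ> pure_tensor K NN N s) (\<zero>\<^bsub>K\<^esub>, z) = (?r \<circ> pure_tensor K NN N s) (\<zero>\<^bsub>K\<^esub>, z)"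
        using uv by (simp add: s_def lie_shelf_eval bracket_derivation[of x y z] M.a_assoc)
    qed
    then show "?l (pure_tensor K NN N (pure_tensor K N N u v) w) =
        ?r (pure_tensor K NN N (pure_tensor K N N u v) w)"
      by (simp add: s_def)
  qed
  then show ?thesis by (simp add: self_distributive_def Let_def)
qed

end

theorem proposition3p5:
  fixes K :: "('k, 'r) ring_scheme"
    and L :: "('k, 'g, 'm) module_scheme"
    and bracket :: "'g \<Rightarrow> 'g \<Rightarrow> 'g"
  assumes "lie_algebra K L bracket"
    and "ring_char K \<noteq> 2"
  shows "cocommutative_coalgebra_shelf K (lie_coalg K L) (lie_comult K L) lie_counit
    (lie_shelf_op K L bracket)"
proof -
  interpret lie_algebra K L bracket by fact
  show ?thesis
    by (intro cocommutative_coalgebra_shelf.intro cocommutative_coalgebra_shelf_axioms.intro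
        lie_cocommutative_coalgebra lie_shelf_coalgebra_morphism lie_shelf_self_distributive)
qed

end
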